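(* Let $A$ be a unital $C^*$-algebra and let $H$ be a group of invertible elements of $A$ (a subgroup of the group $G$ of invertible elements of $A$). Then $$\operatorname{dist}\left(\mathcal{O}_H(\mathrm{Id}),P^H\right)=\operatorname{dist}\left(\mathrm{Id},P^H\right)=\log(\operatorname{sim}(H))$$ and $$\operatorname{diam}(\mathcal{O}_H(\mathrm{Id}))=2\log(|H|).$$
   Context: $P\subseteq G$ denotes the set of positive invertible elements of $A$, and $\mathrm{Id}$ the unit of $A$. $P$ carries the metric $d(a,b)=\|\log(a^{-1/2}ba^{-1/2})\|$. The group $H$ acts on $P$ by $h\cdot a=I_h(a)=hah^*$; $\mathcal{O}_H(a)=\{hah^*:h\in H\}$ is the orbit of $a$, and $P^H=\{a\in P: hah^*=a\ \forall h\in H\}$ is the fixed point set. For $C,D\subseteq P$: $\operatorname{diam}(D)=\sup_{x,y\in D}d(x,y)$, $\operatorname{dist}(C,D)=\inf_{x\in C,y\in D}d(x,y)$, and $\operatorname{dist}(a,D)=\operatorname{dist}(\{a\},D)$. A unitarizer of $H$ is an invertible $s\in A$ such that $s^{-1}Hs$ consists of unitaries. The size of $H$ is $|H|=\sup_{h\in H}\|h\|$, and the similarity number of $H$ is $\operatorname{sim}(H)=\inf\{\|s\|\|s^{-1}\|: s \text{ is a unitarizer of } H\}$. Conventions: $\inf\emptyset=+\infty$, $\log(+\infty)=+\infty$. *)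

theory Defs
  imports "HOL-Analysis.Analysis" "HOL-Algebra.Group" "HOL-Computational_Algebra.Polynomial"
begin

text \<open>
  The real Banach algebra structure is the one of the library; \<open>scaleC_of_real\<close> makes it the
  restriction of the complex one. Since \<open>real_normed_algebra_1\<close> includes \<open>0 \<noteq> 1\<close>, the zero
  algebra is excluded.
\<close>

class cstar_algebra = real_normed_algebra_1 + banach +
  fixes scaleC :: "complex \<Rightarrow> 'a \<Rightarrow> 'a"
    and adj :: "'a \<Rightarrow> 'a"
  assumes scaleC_add_right: "scaleC z (x + y) = scaleC z x + scaleC z y"
    and scaleC_add_left: "scaleC (z + w) x = scaleC z x + scaleC w x"
    and scaleC_scaleC: "scaleC z (scaleC w x) = scaleC (z * w) x"
    and scaleC_of_real: "scaleC (complex_of_real r) x = scaleR r x"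
    and mult_scaleC_left: "scaleC z x * y = scaleC z (x * y)"
    and mult_scaleC_right: "x * scaleC z y = scaleC z (x * y)"
    and norm_scaleC: "norm (scaleC z x) = cmod z * norm x"
    and adj_add: "adj (x + y) = adj x + adj y"
    and adj_scaleC: "adj (scaleC z x) = scaleC (cnj z) (adj x)"
    and adj_mult: "adj (x * y) = adj y * adj x"
    and adj_adj: "adj (adj x) = x"
    and cstar_identity: "norm (adj x * x) = (norm x)\<^sup>2"

definition mult_monoid :: "('a::monoid_mult) monoid" where
  "mult_monoid = \<lparr>carrier = UNIV, mult = (*), one = 1\<rparr>"

definition inv_group :: "('a::monoid_mult) monoid" where
  "inv_group = units_of mult_monoid"

abbreviation inverse_of :: "'a::monoid_mult \<Rightarrow> 'a" where
  "inverse_of a \<equiv> m_inv inv_group a"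

definition is_unitary :: "'a::cstar_algebra \<Rightarrow> bool" where
  "is_unitary u \<longleftrightarrow> adj u * u = 1 \<and> u * adj u = 1"

definition spectrum :: "'a::cstar_algebra \<Rightarrow> complex set" where
  "spectrum a = {z. a - scaleC z 1 \<notin> carrier inv_group}"

definition is_positive :: "'a::cstar_algebra \<Rightarrow> bool" where
  "is_positive a \<longleftrightarrow> adj a = a \<and> spectrum a \<subseteq> complex_of_real ` {0..}"

definition pos_inv :: "'a::cstar_algebra set" where
  "pos_inv = {a \<in> carrier inv_group. is_positive a}"

definition real_spectrum :: "'a::cstar_algebra \<Rightarrow> real set" where
  "real_spectrum a = {x. complex_of_real x \<in> spectrum a}"

definition poly_at :: "real poly \<Rightarrow> 'a::cstar_algebra \<Rightarrow> 'a" where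
  "poly_at p a = (\<Sum>i\<le>degree p. coeff p i *\<^sub>R a ^ i)"

text \<open>
  \<open>cfc f a\<close> is \<open>f(a)\<close>, for \<open>a\<close> self-adjoint and \<open>f\<close> continuous on the spectrum of \<open>a\<close>: the common
  limit of \<open>p\<^sub>n(a)\<close> over all sequences of polynomials \<open>p\<^sub>n\<close> that converge to \<open>f\<close> uniformly on the
  spectrum. For other \<open>a\<close> or \<open>f\<close> the value is irrelevant.
\<close>

definition cfc :: "(real \<Rightarrow> real) \<Rightarrow> 'a::cstar_algebra \<Rightarrow> 'a" where
  "cfc f a = (THE b. \<forall>p :: nat \<Rightarrow> real poly.
     uniform_limit (real_spectrum a) (\<lambda>n x. poly (p n) x) f sequentially
       \<longrightarrow> (\<lambda>n. poly_at (p n) a) \<longlonglongrightarrow> b)"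

definition inv_sqrt :: "'a::cstar_algebra \<Rightarrow> 'a" where
  "inv_sqrt a = cfc (\<lambda>x. x powr (-1/2)) a"

definition pdist :: "'a::cstar_algebra \<Rightarrow> 'a \<Rightarrow> real" where
  "pdist a b = norm (cfc ln (inv_sqrt a * b * inv_sqrt a))"

text \<open>
  Suprema and infima are taken in the extended reals, so that the infimum of the empty set
  is \<open>\<infinity>\<close> and unbounded suprema are \<open>\<infinity>\<close>.
\<close>

definition pdiam :: "'a::cstar_algebra set \<Rightarrow> ereal" where
  "pdiam D = (SUP x\<in>D. SUP y\<in>D. ereal (pdist x y))"

definition psetdist :: "'a::cstar_algebra set \<Rightarrow> 'a set \<Rightarrow> ereal" where
  "psetdist C D = (INF x\<in>C. INF y\<in>D. ereal (pdist x y))"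

definition act :: "'a::cstar_algebra \<Rightarrow> 'a \<Rightarrow> 'a" where
  "act h a = h * a * adj h"

definition orbit :: "'a::cstar_algebra set \<Rightarrow> 'a \<Rightarrow> 'a set" where
  "orbit H a = {act h a | h. h \<in> H}"

definition fixed_points :: "'a::cstar_algebra set \<Rightarrow> 'a set" where
  "fixed_points H = {a \<in> pos_inv. \<forall>h\<in>H. act h a = a}"

definition unitarizers :: "'a::cstar_algebra set \<Rightarrow> 'a set" where
  "unitarizers H =
     {s \<in> carrier inv_group. \<forall>h\<in>H. is_unitary (inverse_of s * h * s)}"

definition group_size :: "'a::cstar_algebra set \<Rightarrow> ereal" where
  "group_size H = (SUP h\<in>H. ereal (norm h))"

definition sim_number :: "'a::cstar_algebra set \<Rightarrow> ereal" where
  "sim_number H = (INF s\<in>unitarizers H. ereal (norm s * norm (inverse_of s)))"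

definition log_ereal :: "ereal \<Rightarrow> ereal" where
  "log_ereal x = (case x of
       ereal r \<Rightarrow> if r > 0 then ereal (ln r) else -\<infinity>
     | PInfty \<Rightarrow> \<infinity>
     | MInfty \<Rightarrow> -\<infinity>)"

end

theory Submission
  imports Defs "HOL-Computational_Algebra.Fundamental_Theorem_Algebra"
begin

text \<open>
  The number \<open>d(a, b)\<close> is the largest \<open>\<bar>ln t\<bar>\<close> with \<open>t\<close> in the spectrum of
  \<open>a\<^sup>-\<^sup>1\<^sup>/\<^sup>2 b a\<^sup>-\<^sup>1\<^sup>/\<^sup>2\<close>, which is similar to \<open>b a\<^sup>-\<^sup>1\<close>. Under \<open>a \<mapsto> g a g\<^sup>*\<close>, \<open>b \<mapsto> g b g\<^sup>*\<close> the
  element \<open>b a\<^sup>-\<^sup>1\<close> is conjugated by \<open>g\<close>, so every invertible \<open>g\<close> acts isometrically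
  (\<open>pdist_act\<close>). For \<open>a = 1\<close> the same description says that \<open>d(1, g g\<^sup>*)\<close> is the maximum of
  \<open>2 ln \<parallel>g\<parallel>\<close> and \<open>2 ln \<parallel>g\<^sup>-\<^sup>1\<parallel>\<close> (\<open>pdist_one_act_le_iff\<close>). The theorem follows:

  \<^item> Each \<open>h\<close> in \<open>H\<close> takes \<open>1\<close> to \<open>h h\<^sup>*\<close> and moves no point of \<open>P\<^sup>H\<close>, so all points of the orbit are
    equally far from each fixed point.

  \<^item> The fixed points are the elements \<open>s s\<^sup>*\<close> with \<open>s\<close> a unitarizer
    (\<open>fixed_points_eq_act_unitarizers\<close>). Unitarizers may be rescaled, and the best multiple of
    \<open>s\<close> has \<open>\<parallel>s\<parallel> = \<parallel>s\<^sup>-\<^sup>1\<parallel>\<close>, with \<open>d(1, s s\<^sup>*) = ln (\<parallel>s\<parallel> \<parallel>s\<^sup>-\<^sup>1\<parallel>)\<close>.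

  \<^item> Translating by \<open>h\<^sup>-\<^sup>1\<close> turns \<open>d(h h\<^sup>*, k k\<^sup>*)\<close> into \<open>d(1, g g\<^sup>*)\<close> with \<open>g = h\<^sup>-\<^sup>1 k\<close> in \<open>H\<close>, and \<open>H\<close>
    contains \<open>g\<^sup>-\<^sup>1\<close> along with \<open>g\<close>.

  The operator-theoretic substance lies in making sense of \<open>d\<close>. A self-adjoint element has real
  spectrum (\<open>spectrum_self_adjoint_real\<close>) and attains its norm there (\<open>norm_attained_on_spectrum\<close>,
  an averaging argument of Rickart that replaces complex analysis). With spectral mapping for
  polynomials this makes \<open>p \<mapsto> p(a)\<close> isometric for the supremum norm on the spectrum, so \<open>cfc\<close> is a
  limit that exists and is multiplicative. Finally \<open>x\<^sup>* x\<close> is positive (\<open>adj_mult_self_positive\<close>,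
  the argument of Fukamiya and Kaplansky), so the points \<open>h h\<^sup>*\<close> and \<open>a\<^sup>-\<^sup>1\<^sup>/\<^sup>2 b a\<^sup>-\<^sup>1\<^sup>/\<^sup>2\<close> lie in the domain
  of the square root and of the logarithm.
\<close>

section \<open>Invertible elements\<close>

abbreviation units :: "'a::monoid_mult set" where
  "units \<equiv> carrier inv_group"

lemma units_iff: "a \<in> units \<longleftrightarrow> (\<exists>b. a * b = 1 \<and> b * a = 1)" for a :: "'a::monoid_mult"
  by (auto simp: inv_group_def units_of_def mult_monoid_def Units_def)

lemma unitsI:
  fixes a :: "'a::monoid_mult"
  assumes "a * r = 1" "l * a = 1"
  shows "a \<in> units"
proof -
  have "l = r"
    by (metis assms mult.assoc mult_1_left mult_1_right)
  then show ?thesis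
    using assms units_iff by blast
qed

lemma group_inv_group: "group (inv_group :: 'a::monoid_mult monoid)"
proof -
  have "monoid (mult_monoid :: 'a monoid)"
    by (rule monoidI) (auto simp: mult_monoid_def mult.assoc)
  then show ?thesis
    unfolding inv_group_def by (rule monoid.units_group)
qed

lemma inv_group_simps [simp]:
  "mult (inv_group :: 'a::monoid_mult monoid) = (*)" "one (inv_group :: 'a monoid) = 1"
  by (auto simp: inv_group_def units_of_def mult_monoid_def)

lemma inverse_of_units:
  fixes a :: "'a::monoid_mult"
  assumes "a \<in> units"
  shows "a * inverse_of a = 1" "inverse_of a * a = 1" "inverse_of a \<in> units"
  using group.r_inv[OF group_inv_group assms] group.l_inv[OF group_inv_group assms]
    group.inv_closed[OF group_inv_group assms] by simp_all

lemma inverse_of_units_cancel: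
  fixes a :: "'a::monoid_mult"
  assumes "a \<in> units"
  shows "a * (inverse_of a * x) = x" "inverse_of a * (a * x) = x"
  by (simp_all add: inverse_of_units[OF assms] flip: mult.assoc)

lemma inverse_of_eqI:
  fixes a :: "'a::monoid_mult"
  assumes "a * b = 1" "b * a = 1"
  shows "inverse_of a = b"
proof -
  have "a \<in> units"
    using assms by (rule unitsI)
  then show ?thesis
    by (metis assms(1) inverse_of_units_cancel(2) mult_1_right)
qed

lemma units_one: "1 \<in> (units :: 'a::monoid_mult set)"
  by (auto simp: units_iff)

lemma units_mult: "a * b \<in> units" if "a \<in> units" "b \<in> units" for a b :: "'a::monoid_mult"
  using that inverse_of_units_cancel[of a] inverse_of_units_cancel[of b]
  by (intro unitsI[of _ "inverse_of b * inverse_of a" "inverse_of b * inverse_of a"])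
    (simp_all add: mult.assoc inverse_of_units)

lemma units_factor:
  fixes x y :: "'a::monoid_mult"
  assumes "x * y \<in> units" "x * y = y * x"
  shows "x \<in> units"
proof (rule unitsI)
  show "x * (y * inverse_of (x * y)) = 1"
    using inverse_of_units(1)[OF assms(1)] by (simp add: mult.assoc)
  show "(inverse_of (x * y) * y) * x = 1"
    using inverse_of_units(2)[OF assms(1)] by (simp add: mult.assoc flip: assms(2))
qed

lemma units_cancel:
  fixes x y :: "'a::monoid_mult"
  assumes "x \<in> units"
  shows "x * y \<in> units \<longleftrightarrow> y \<in> units" "y * x \<in> units \<longleftrightarrow> y \<in> units"
proof -
  show "x * y \<in> units \<longleftrightarrow> y \<in> units"
    by (metis assms inverse_of_units(3) inverse_of_units_cancel(2) units_mult)
  have "y * x * inverse_of x = y"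
    by (simp add: mult.assoc inverse_of_units assms)
  then show "y * x \<in> units \<longleftrightarrow> y \<in> units"
    by (metis assms inverse_of_units(3) units_mult)
qed

lemma units_scaleR:
  fixes x :: "'a::real_algebra_1"
  assumes "c \<noteq> 0"
  shows "c *\<^sub>R x \<in> units \<longleftrightarrow> x \<in> units"
proof -
  have "c *\<^sub>R (1::'a) \<in> units"
    by (rule unitsI[of _ "inverse c *\<^sub>R 1" "inverse c *\<^sub>R 1"]) (use assms in auto)
  from units_cancel(1)[OF this, of x] show ?thesis
    by simp
qed

lemma units_minus: "- x \<in> units \<longleftrightarrow> x \<in> units" for x :: "'a::real_algebra_1"
  using units_scaleR[of "-1" x] by simp

lemma norm_units_ge_1:
  fixes a :: "'a::real_normed_algebra_1"
  assumes "a \<in> units"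
  shows "norm a * norm (inverse_of a) \<ge> 1"
  by (metis assms inverse_of_units(1) norm_mult_ineq norm_one)

text \<open>Both parts come from the geometric series, whose sum \<open>s\<close> satisfies \<open>s - 1 = x (s - 1) + x\<close>.\<close>

lemma neumann:
  fixes x :: "'a::{real_normed_algebra_1,banach}"
  assumes "norm x < 1"
  shows "1 - x \<in> units" "norm (inverse_of (1 - x) - 1) \<le> norm x / (1 - norm x)"
proof -
  define s where "s = (\<Sum>n. x ^ n)"
  have sm: "summable (\<lambda>n. x ^ n)"
    by (rule complete_algebra_summable_geometric[OF assms])
  have s: "s = 1 + (\<Sum>n. x ^ Suc n)"
    using suminf_split_head[OF sm] by (simp add: s_def)
  have "(\<Sum>n. x ^ Suc n) = x * s"
    using suminf_mult[OF sm, of x] by (simp add: s_def)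
  then have 1: "(1 - x) * s = 1"
    using s by (simp add: algebra_simps)
  have "(\<Sum>n. x ^ Suc n) = s * x"
    using suminf_mult2[OF sm, of x] by (simp add: s_def power_commutes)
  then have 2: "s * (1 - x) = 1"
    using s by (simp add: algebra_simps)
  show "1 - x \<in> units"
    using 1 2 by (rule unitsI)
  have i: "inverse_of (1 - x) = s"
    using 1 2 by (rule inverse_of_eqI)
  have e: "s - 1 = x * (s - 1) + x"
    using 1 by (simp add: algebra_simps)
  have "norm (s - 1) \<le> norm x * norm (s - 1) + norm x"
    by (metis e norm_mult_ineq norm_triangle_le add_mono order_refl)
  then show "norm (inverse_of (1 - x) - 1) \<le> norm x / (1 - norm x)"
    using assms by (simp add: i pos_le_divide_eq algebra_simps)
qed

section \<open>Spectra\<close>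

lemma scaleC_zero_left [simp]: "scaleC 0 (x :: 'a::cstar_algebra) = 0"
  using scaleC_of_real[of 0 x] by simp

lemma scaleC_one [simp]: "scaleC 1 (x :: 'a::cstar_algebra) = x"
  using scaleC_of_real[of 1 x] by simp

lemma scaleC_zero_right [simp]: "scaleC z (0 :: 'a::cstar_algebra) = 0"
  using scaleC_add_right[of z 0 "0::'a"] by simp

lemma scaleC_minus_left: "scaleC (- z) x = - scaleC z (x :: 'a::cstar_algebra)"
  using scaleC_add_left[of z "-z" x] by (simp add: add_eq_0_iff)

lemma scaleC_minus_right: "scaleC z (- x) = - scaleC z (x :: 'a::cstar_algebra)"
  using scaleC_add_right[of z x "-x"] by (simp add: add_eq_0_iff)

lemma scaleC_diff_left: "scaleC (z - w) x = scaleC z x - scaleC w (x :: 'a::cstar_algebra)"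
  using scaleC_add_left[of z "- w" x] by (simp add: scaleC_minus_left)

lemma scaleC_diff_right: "scaleC z (x - y) = scaleC z x - scaleC z (y :: 'a::cstar_algebra)"
  using scaleC_add_right[of z x "- y"] by (simp add: scaleC_minus_right)

lemma units_scaleC:
  fixes x :: "'a::cstar_algebra"
  assumes "z \<noteq> 0"
  shows "scaleC z x \<in> units \<longleftrightarrow> x \<in> units"
proof -
  have "scaleC z (1::'a) \<in> units"
    by (rule unitsI[of _ "scaleC (inverse z) 1" "scaleC (inverse z) 1"])
      (use assms in \<open>auto simp: mult_scaleC_left scaleC_scaleC\<close>)
  from units_cancel(1)[OF this, of x] show ?thesis
    by (simp add: mult_scaleC_left)
qed

lemma spectrum_iff_resolvent:
  fixes a :: "'a::cstar_algebra"
  assumes "z \<noteq> 0"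
  shows "z \<in> spectrum a \<longleftrightarrow> 1 - scaleC (inverse z) a \<notin> units"
proof -
  have "scaleC (- z) (1 - scaleC (inverse z) a) = a - scaleC z 1"
    using assms by (simp add: scaleC_diff_right scaleC_minus_left scaleC_scaleC)
  then show ?thesis
    using units_scaleC[of "-z" "1 - scaleC (inverse z) a"] assms by (simp add: spectrum_def)
qed

lemma spectrum_norm_le:
  fixes a :: "'a::cstar_algebra"
  assumes "z \<in> spectrum a"
  shows "cmod z \<le> norm a"
proof (rule ccontr)
  assume *: "\<not> ?thesis"
  then have "z \<noteq> 0"
    by auto
  have "norm (scaleC (inverse z) a) < 1"
    using * \<open>z \<noteq> 0\<close> by (simp add: norm_scaleC norm_inverse pos_less_divide_eq divide_less_eq flip: divide_inverse_commute)
  from neumann(1)[OF this] show False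
    using assms spectrum_iff_resolvent[OF \<open>z \<noteq> 0\<close>] by blast
qed

lemma zero_spectrum_iff: "0 \<in> spectrum a \<longleftrightarrow> (a :: 'a::cstar_algebra) \<notin> units"
  by (simp add: spectrum_def)

lemma spectrum_minus: "z \<in> spectrum (- a) \<longleftrightarrow> - z \<in> spectrum (a :: 'a::cstar_algebra)"
proof -
  have "- a - scaleC z 1 = - (a - scaleC (- z) 1)"
    by (simp add: scaleC_minus_left)
  then show ?thesis
    unfolding spectrum_def mem_Collect_eq by (simp only: units_minus)
qed

lemma spectrum_real_shift:
  "z \<in> spectrum (t *\<^sub>R 1 - a) \<longleftrightarrow> of_real t - z \<in> spectrum (a :: 'a::cstar_algebra)"
proof -
  have "t *\<^sub>R 1 - a - scaleC z 1 = - (a - scaleC (of_real t - z) 1)"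
    by (simp add: scaleC_diff_left scaleC_of_real)
  then show ?thesis
    unfolding spectrum_def mem_Collect_eq by (simp only: units_minus)
qed

lemma spectrum_scaleR:
  assumes "t \<noteq> 0"
  shows "of_real t * z \<in> spectrum (t *\<^sub>R a) \<longleftrightarrow> z \<in> spectrum (a :: 'a::cstar_algebra)"
proof -
  have "t *\<^sub>R a - scaleC (of_real t * z) 1 = t *\<^sub>R (a - scaleC z 1)"
    by (simp add: scaleC_diff_right flip: scaleC_of_real scaleC_scaleC)
  then show ?thesis
    using assms by (simp add: spectrum_def units_scaleR)
qed

lemma spectrum_inverse:
  fixes a :: "'a::cstar_algebra"
  assumes "a \<in> units" "z \<noteq> 0" "z \<in> spectrum a"
  shows "inverse z \<in> spectrum (inverse_of a)"
proof -
  have "scaleC (- z) (a * (inverse_of a - scaleC (inverse z) 1)) = a - scaleC z 1"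
    using assms by (simp add: algebra_simps inverse_of_units mult_scaleC_right scaleC_diff_right
        scaleC_minus_left scaleC_scaleC)
  then show ?thesis
    using units_scaleC[of "-z"] units_cancel(1)[OF assms(1)] assms(2,3)
    by (metis (no_types, lifting) mem_Collect_eq neg_equal_0_iff_equal spectrum_def)
qed

text \<open>
  The formal identity \<open>\<Sum> (y x)\<^sup>n = 1 + y (\<Sum> (x y)\<^sup>n) x\<close> suggests the inverse \<open>1 + y r x\<close>, where \<open>r\<close>
  inverts \<open>1 - x y\<close>.
\<close>

lemma one_minus_mult_units:
  fixes x y :: "'a::ring_1"
  assumes "1 - x * y \<in> units"
  shows "1 - y * x \<in> units"
proof -
  define r where "r = inverse_of (1 - x * y)"
  have "(1 - x * y) * r = 1" "r * (1 - x * y) = 1"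
    using inverse_of_units[OF assms] by (simp_all add: r_def)
  then have r: "r = 1 + x * y * r" "r = 1 + r * x * y"
    by (simp_all add: algebra_simps)
  show ?thesis
  proof (rule unitsI)
    have "(1 - y * x) * (1 + y * r * x) = 1 - y * x + y * (r - x * y * r) * x"
      by (simp add: algebra_simps)
    also have "r - x * y * r = 1"
      using r(1) by (simp add: algebra_simps)
    finally show "(1 - y * x) * (1 + y * r * x) = 1"
      by simp
    have "(1 + y * r * x) * (1 - y * x) = 1 - y * x + y * (r - r * x * y) * x"
      by (simp add: algebra_simps)
    also have "r - r * x * y = 1"
      using r(2) by (simp add: algebra_simps)
    finally show "(1 + y * r * x) * (1 - y * x) = 1"
      by simp
  qed
qed

lemma spectrum_mult_commute:
  fixes x y :: "'a::cstar_algebra"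
  assumes "z \<in> spectrum (x * y)" "z \<noteq> 0"
  shows "z \<in> spectrum (y * x)"
proof (rule ccontr)
  assume "z \<notin> spectrum (y * x)"
  then have "1 - y * scaleC (inverse z) x \<in> units"
    using spectrum_iff_resolvent[OF assms(2), of "y * x"] by (simp add: mult_scaleC_right)
  then have "1 - scaleC (inverse z) x * y \<in> units"
    by (rule one_minus_mult_units)
  then show False
    using assms(1) spectrum_iff_resolvent[OF assms(2), of "x * y"] by (simp add: mult_scaleC_left)
qed

lemma spectrum_conj:
  fixes a g :: "'a::cstar_algebra"
  assumes "g \<in> units"
  shows "spectrum (g * a * inverse_of g) = spectrum a"
proof -
  have "g * a * inverse_of g - scaleC z 1 = g * (a - scaleC z 1) * inverse_of g" for z
    by (simp add: algebra_simps mult_scaleC_right mult_scaleC_left inverse_of_units assms)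
  then show ?thesis
    by (simp add: spectrum_def units_cancel assms inverse_of_units)
qed

section \<open>Self-adjoint elements\<close>

lemma adj_zero [simp]: "adj (0 :: 'a::cstar_algebra) = 0"
  using adj_add[of 0 "0::'a"] by simp

lemma adj_one [simp]: "adj (1 :: 'a::cstar_algebra) = 1"
  by (metis adj_adj adj_mult mult_1_left mult_1_right)

lemma adj_scaleR [simp]: "adj (t *\<^sub>R x) = t *\<^sub>R adj (x :: 'a::cstar_algebra)"
  using adj_scaleC[of "of_real t" x] by (simp add: scaleC_of_real)

lemma adj_minus: "adj (- x) = - adj (x :: 'a::cstar_algebra)"
  using adj_scaleR[of "-1" x] by simp

lemma adj_diff: "adj (x - y) = adj x - adj (y :: 'a::cstar_algebra)"
  using adj_add[of x "-y"] by (simp add: adj_minus)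

lemma adj_power: "adj (x ^ n) = adj (x :: 'a::cstar_algebra) ^ n"
  by (induction n) (simp_all add: adj_mult power_commutes)

lemma adj_inverse_of:
  fixes x :: "'a::cstar_algebra"
  assumes "x \<in> units"
  shows "adj x \<in> units" "inverse_of (adj x) = adj (inverse_of x)"
proof -
  have *: "adj x * adj (inverse_of x) = 1" "adj (inverse_of x) * adj x = 1"
    by (simp_all add: inverse_of_units assms flip: adj_mult)
  show "adj x \<in> units"
    using * by (rule unitsI)
  show "inverse_of (adj x) = adj (inverse_of x)"
    using * by (rule inverse_of_eqI)
qed

lemma norm_adj [simp]: "norm (adj x) = norm (x :: 'a::cstar_algebra)"
proof -
  have "norm x \<le> norm (adj x)" for x :: 'a
  proof (cases "norm x = 0")
    case False
    have "norm x * norm x \<le> norm (adj x) * norm x"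
      using norm_mult_ineq[of "adj x" x] by (simp add: cstar_identity power2_eq_square)
    then show ?thesis
      using False by simp
  qed simp
  from this[of x] this[of "adj x"] show ?thesis
    by (simp add: adj_adj)
qed

lemma cstar_identity': "norm (x * adj x) = (norm (x :: 'a::cstar_algebra))\<^sup>2"
  using cstar_identity[of "adj x"] by (simp add: adj_adj)

lemma tendsto_adj:
  fixes f :: "'b \<Rightarrow> 'a::cstar_algebra"
  assumes "(f \<longlongrightarrow> l) F"
  shows "((\<lambda>n. adj (f n)) \<longlongrightarrow> adj l) F"
  using assms by (simp add: tendsto_iff dist_norm flip: adj_diff)

lemma norm_power_2power_self_adjoint:
  fixes a :: "'a::cstar_algebra"
  assumes "adj a = a"
  shows "norm (a ^ (2 ^ k)) = norm a ^ (2 ^ k)"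
proof (induction k)
  case (Suc k)
  have "norm (a ^ 2 ^ Suc k) = norm (adj (a ^ 2 ^ k) * a ^ 2 ^ k)"
    using assms by (simp add: adj_power power_mult mult.commute power2_eq_square power_mult_distrib
        flip: power_add mult_2)
  then show ?case
    using Suc by (simp add: cstar_identity mult.commute flip: power_mult)
qed simp

text \<open>
  Arens' trick: adding \<open>i \<lambda>\<close> to \<open>a\<close> moves a point \<open>\<alpha> + i \<beta>\<close> of its spectrum by \<open>i \<lambda>\<close>, and
  \<open>\<parallel>a + i \<lambda>\<parallel>\<^sup>2 \<le> \<parallel>a\<parallel>\<^sup>2 + \<lambda>\<^sup>2\<close>, so \<open>\<alpha>\<^sup>2 + \<beta>\<^sup>2 + 2 \<beta> \<lambda> \<le> \<parallel>a\<parallel>\<^sup>2\<close> for all real \<open>\<lambda>\<close>.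
\<close>

lemma spectrum_self_adjoint_real:
  fixes a :: "'a::cstar_algebra"
  assumes "adj a = a" "z \<in> spectrum a"
  shows "Im z = 0"
proof (rule ccontr)
  assume nz: "Im z \<noteq> 0"
  have bound: "(Re z)\<^sup>2 + (Im z)\<^sup>2 + 2 * Im z * l \<le> (norm a)\<^sup>2" for l :: real
  proof -
    define b where "b = a + scaleC (\<i> * of_real l) 1"
    have "b - scaleC (z + \<i> * of_real l) 1 = a - scaleC z 1"
      by (simp add: b_def scaleC_add_left)
    then have "z + \<i> * of_real l \<in> spectrum b"
      using assms by (simp add: spectrum_def)
    then have "(cmod (z + \<i> * of_real l))\<^sup>2 \<le> (norm b)\<^sup>2"
      by (intro power_mono spectrum_norm_le) auto
    also have "(norm b)\<^sup>2 = norm (adj b * b)"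
      by (simp add: cstar_identity)
    also have "adj b * b = a * a + l\<^sup>2 *\<^sub>R 1"
      using assms by (simp add: b_def adj_add adj_scaleC algebra_simps mult_scaleC_left
          mult_scaleC_right scaleC_scaleC scaleC_minus_left scaleC_diff_right power2_eq_square flip: scaleC_of_real)
    also have "norm \<dots> \<le> (norm a)\<^sup>2 + l\<^sup>2"
      using norm_triangle_ineq[of "a * a" "l\<^sup>2 *\<^sub>R 1"] norm_mult_ineq[of a a]
      by (simp add: power2_eq_square abs_mult)
    finally show ?thesis
      unfolding cmod_power2 by (simp add: power2_eq_square algebra_simps)
  qed
  have "2 * Im z * (((norm a)\<^sup>2 + 1) / (2 * Im z)) = (norm a)\<^sup>2 + 1"
    using nz by simp
  with bound[of "((norm a)\<^sup>2 + 1) / (2 * Im z)"]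
  have "(Re z)\<^sup>2 + (Im z)\<^sup>2 + ((norm a)\<^sup>2 + 1) \<le> (norm a)\<^sup>2"
    by (simp only:)
  then show False
    using zero_le_power2[of "Re z"] zero_le_power2[of "Im z"] by linarith
qed

lemma spectrum_self_adjointE:
  fixes a :: "'a::cstar_algebra"
  assumes "adj a = a" "z \<in> spectrum a"
  obtains t where "z = of_real t" "t \<in> real_spectrum a"
  using spectrum_self_adjoint_real[OF assms] assms(2)
  by (metis complex_is_Real_iff Reals_cases mem_Collect_eq real_spectrum_def)

section \<open>The norm of a self-adjoint element is attained on its spectrum\<close>

lemma continuous_on_resolvent:
  fixes a :: "'a::cstar_algebra"
  assumes inv: "\<And>z. z \<in> S \<Longrightarrow> 1 - scaleC z a \<in> units"
  shows "continuous_on S (\<lambda>z. inverse_of (1 - scaleC z a))"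
proof -
  define f where "f z = inverse_of (1 - scaleC z a)" for z
  have resolvent_identity: "f w - f z = scaleC (w - z) (f w * a * f z)" if "w \<in> S" "z \<in> S" for w z
  proof -
    have "f w - f z = f w * ((1 - scaleC z a) * f z) - (f w * (1 - scaleC w a)) * f z"
      unfolding f_def inverse_of_units(1)[OF inv[OF that(2)]] inverse_of_units(2)[OF inv[OF that(1)]]
      by simp
    also have "\<dots> = f w * ((1 - scaleC z a) - (1 - scaleC w a)) * f z"
      by (simp only: left_diff_distrib right_diff_distrib mult.assoc)
    also have "(1 - scaleC z a) - (1 - scaleC w a) = scaleC (w - z) a"
      by (simp add: scaleC_diff_left)
    finally show ?thesis
      by (simp add: mult_scaleC_left mult_scaleC_right)
  qed
  have est: "norm (f w - f z) \<le> cmod (w - z) * (norm (f w) * norm a * norm (f z))"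
    if "w \<in> S" "z \<in> S" for w z
    unfolding resolvent_identity[OF that] norm_scaleC
    by (intro mult_left_mono norm_ge_zero order_trans[OF norm_mult_ineq] mult_right_mono norm_mult_ineq)
  have "continuous_on S f"
    unfolding continuous_on_iff
  proof safe
    fix z and e :: real
    assume z: "z \<in> S" and "e > 0"
    \<comment> \<open>Within \<open>1 / (2 K)\<close> of \<open>z\<close> the resolvent identity gives \<open>norm (f w) \<le> 2 * norm (f z)\<close>, and hence the Lipschitz constant \<open>L\<close>.\<close>
    define K where "K = norm a * norm (f z) + 1"
    have "K > 0"
      by (simp add: K_def add_nonneg_pos)
    define L where "L = 2 * norm (f z) * K + 1"
    have "L > 0"
      using \<open>K > 0\<close> by (simp add: L_def add_nonneg_pos)
    define d where "d = min (1 / (2 * K)) (e / L)"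
    have "d > 0"
      using \<open>K > 0\<close> \<open>L > 0\<close> \<open>e > 0\<close> by (simp add: d_def)
    moreover have "dist (f w) (f z) < e" if w: "w \<in> S" "dist w z < d" for w
    proof -
      have d: "cmod (w - z) \<le> 1 / (2 * K)" "cmod (w - z) < e / L"
        using w(2) by (auto simp: d_def dist_norm)
      have *: "norm (f w - f z) \<le> cmod (w - z) * (norm (f w) * K)"
        using est[OF w(1) z] by (rule order_trans)
          (auto simp: K_def algebra_simps intro!: mult_left_mono)
      also have "\<dots> \<le> 1 / (2 * K) * (norm (f w) * K)"
        using d(1) \<open>K > 0\<close> by (intro mult_right_mono) auto
      also have "\<dots> = norm (f w) / 2"
        using \<open>K > 0\<close> by simp
      finally have "norm (f w) \<le> 2 * norm (f z)"
        using norm_triangle_sub[of "f w" "f z"] by linarith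
      then have "norm (f w) * K \<le> L"
        using \<open>K > 0\<close> by (simp add: L_def add.commute add_increasing)
      then have "norm (f w - f z) \<le> cmod (w - z) * L"
        using * by (meson mult_left_mono norm_ge_zero order_trans)
      also have "\<dots> < e"
        using d(2) \<open>L > 0\<close> by (simp add: pos_less_divide_eq)
      finally show ?thesis
        by (simp add: dist_norm)
    qed
    ultimately show "\<exists>d>0. \<forall>w\<in>S. dist w z < d \<longrightarrow> dist (f w) (f z) < e"
      by blast
  qed
  then show ?thesis
    by (simp add: f_def[abs_def])
qed

text \<open>
  Partial fractions: \<open>(1 - x\<^sup>2)\<^sup>-\<^sup>1\<close> is the mean of \<open>(1 - x)\<^sup>-\<^sup>1\<close> and \<open>(1 + x)\<^sup>-\<^sup>1\<close>.
\<close>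

lemma inverse_one_minus_square:
  fixes x :: "'a::real_algebra_1"
  assumes "1 - x \<in> units" "1 + x \<in> units"
  shows "1 - x * x \<in> units"
    "inverse_of (1 - x * x) = (1/2) *\<^sub>R (inverse_of (1 - x) + inverse_of (1 + x))"
proof -
  define p q where "p = inverse_of (1 - x)" and "q = inverse_of (1 + x)"
  have p: "(1 - x) * p = 1" "p * (1 - x) = 1" and q: "(1 + x) * q = 1" "q * (1 + x) = 1"
    using assms by (simp_all add: p_def q_def inverse_of_units)
  have f: "1 - x * x = (1 + x) * (1 - x)" "1 - x * x = (1 - x) * (1 + x)"
    by (simp_all add: algebra_simps)
  show "1 - x * x \<in> units"
    unfolding f(1) using assms by (intro units_mult)
  have "(1 - x * x) * (p + q) = (1 + x) * ((1 - x) * p) + (1 - x) * ((1 + x) * q)"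
    using f by (simp only: distrib_left flip: mult.assoc)
  also have "\<dots> = 2 *\<^sub>R 1"
    by (simp add: p q scaleR_2)
  finally have 1: "(1 - x * x) * ((1/2) *\<^sub>R (p + q)) = 1"
    by simp
  have "(p + q) * (1 - x * x) = (p * (1 - x)) * (1 + x) + (q * (1 + x)) * (1 - x)"
    using f by (simp only: distrib_right mult.assoc)
  also have "\<dots> = 2 *\<^sub>R 1"
    by (simp add: p q scaleR_2)
  finally have 2: "((1/2) *\<^sub>R (p + q)) * (1 - x * x) = 1"
    by simp
  show "inverse_of (1 - x * x) = (1/2) *\<^sub>R (inverse_of (1 - x) + inverse_of (1 + x))"
    using inverse_of_eqI[OF 1 2] by (simp add: p_def q_def)
qed

text \<open>
  For \<open>N = 2\<^sup>k\<close> the element \<open>(1 - w\<^sup>N a\<^sup>N)\<^sup>-\<^sup>1\<close> is the mean of the resolvents \<open>(1 - \<omega> w a)\<^sup>-\<^sup>1\<close> over the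
  \<open>N\<close>-th roots of unity \<open>\<omega>\<close>. A bound for the difference of the resolvents on the circles of radius
  \<open>1\<close> and \<open>t\<close> therefore survives the passage from \<open>a\<close> to \<open>a\<^sup>N\<close>, uniformly in \<open>N\<close>. Powers of two make
  the averaging a repeated use of the preceding partial fractions, and for self-adjoint \<open>a\<close>
  they are the exponents with \<open>\<parallel>a\<^sup>N\<parallel> = \<parallel>a\<parallel>\<^sup>N\<close> by the \<open>C\<^sup>*\<close>-identity alone.
\<close>

lemma averaged_resolvent:
  fixes a :: "'a::cstar_algebra"
  assumes inv: "\<And>z. cmod z \<le> 1 \<Longrightarrow> 1 - scaleC z a \<in> units"
    and close: "\<And>z. cmod z = 1 \<Longrightarrow>
      norm (inverse_of (1 - scaleC z a) - inverse_of (1 - scaleC (of_real t * z) a)) \<le> e"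
    and t: "0 \<le> t" "t \<le> 1" and w: "cmod w = 1"
  shows "1 - scaleC (w ^ 2 ^ k) (a ^ 2 ^ k) \<in> units \<and>
    1 - scaleC ((of_real t * w) ^ 2 ^ k) (a ^ 2 ^ k) \<in> units \<and>
    norm (inverse_of (1 - scaleC (w ^ 2 ^ k) (a ^ 2 ^ k))
        - inverse_of (1 - scaleC ((of_real t * w) ^ 2 ^ k) (a ^ 2 ^ k))) \<le> e"
  using w
proof (induction k arbitrary: w)
  case 0
  have "cmod (of_real t * w) \<le> 1"
    using t 0 by (simp add: norm_mult)
  then show ?case
    using 0 inv close by simp
next
  case (Suc k)
  \<comment> \<open>Rotating by \<open>\<eta>\<close> changes the sign of \<open>z ^ 2 ^ k\<close>, so the factor \<open>1 + x\<close> is again of the form \<open>1 - x\<close>.\<close>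
  define \<eta> where "\<eta> = cis (pi / 2 ^ k)"
  have \<eta>: "\<eta> ^ 2 ^ k = -1" "cmod \<eta> = 1"
    using Complex.DeMoivre[of "pi / 2 ^ k" "2 ^ k"] by (simp_all add: \<eta>_def)
  define x where "x z = scaleC (z ^ 2 ^ k) (a ^ 2 ^ k)" for z
  have x\<eta>: "1 + x z = 1 - x (z * \<eta>)" for z
    by (simp add: x_def power_mult_distrib \<eta> scaleC_minus_left)
  have xx: "x z * x z = scaleC (z ^ 2 ^ Suc k) (a ^ 2 ^ Suc k)" for z
    by (simp add: x_def mult_scaleC_left mult_scaleC_right scaleC_scaleC mult_2 power_add)
  have w\<eta>: "cmod (w * \<eta>) = 1" and assoc: "of_real t * (w * \<eta>) = of_real t * w * \<eta>"
    using Suc.prems \<eta> by (simp_all add: norm_mult)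
  from Suc.IH[folded x_def, OF Suc.prems]
  have IH1: "1 - x w \<in> units" "1 - x (of_real t * w) \<in> units"
    "norm (inverse_of (1 - x w) - inverse_of (1 - x (of_real t * w))) \<le> e"
    by blast+
  from Suc.IH[folded x_def, OF w\<eta>, unfolded assoc]
  have IH2: "1 - x (w * \<eta>) \<in> units" "1 - x (of_real t * w * \<eta>) \<in> units"
    "norm (inverse_of (1 - x (w * \<eta>)) - inverse_of (1 - x (of_real t * w * \<eta>))) \<le> e"
    by blast+
  note S1 = inverse_one_minus_square[of "x w", unfolded x\<eta>, OF IH1(1) IH2(1), unfolded xx]
  note S2 = inverse_one_minus_square[of "x (of_real t * w)", unfolded x\<eta>,
      OF IH1(2) IH2(2), unfolded xx]
  define d where "d z = inverse_of (1 - x z) - inverse_of (1 - x (of_real t * z))" for z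
  have "inverse_of (1 - scaleC (w ^ 2 ^ Suc k) (a ^ 2 ^ Suc k))
         - inverse_of (1 - scaleC ((of_real t * w) ^ 2 ^ Suc k) (a ^ 2 ^ Suc k))
       = (1/2) *\<^sub>R (d w + d (w * \<eta>))"
    unfolding S1(2) S2(2) d_def assoc by (simp add: scaleR_diff_right scaleR_add_right)
  moreover have "norm (d w + d (w * \<eta>)) \<le> e + e"
    unfolding d_def assoc by (intro norm_triangle_le add_mono IH1 IH2)
  ultimately show ?case
    using S1(1) S2(1) by simp
qed

text \<open>
  Otherwise \<open>1 - z a\<close> is invertible on the closed unit disc and its inverse is uniformly continuous
  there. Averaging then puts \<open>(1 - a\<^sup>N)\<^sup>-\<^sup>1\<close> close to \<open>(1 - t\<^sup>N a\<^sup>N)\<^sup>-\<^sup>1\<close> for some \<open>t < 1\<close> and all \<open>N = 2\<^sup>k\<close>.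
  Since \<open>\<parallel>a\<^sup>N\<parallel> = 1\<close>, the latter tends to \<open>1\<close>; so \<open>1 - a\<^sup>N\<close> is eventually within \<open>1/2\<close> of \<open>1\<close>, which is
  impossible for an \<open>a\<^sup>N\<close> of norm \<open>1\<close>.
\<close>

lemma self_adjoint_norm_one_spectrum:
  fixes a :: "'a::cstar_algebra"
  assumes sa: "adj a = a" and n1: "norm a = 1"
  shows "\<exists>z. cmod z = 1 \<and> z \<in> spectrum a"
proof (rule ccontr)
  assume *: "\<not> ?thesis"
  have inv: "1 - scaleC z a \<in> units" if "cmod z \<le> 1" for z
  proof (cases "cmod z = 1")
    case True
    then have "inverse z \<notin> spectrum a"
      using * by (auto simp: norm_inverse)
    moreover have "inverse z \<noteq> 0"
      using True by auto
    ultimately show ?thesis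
      using spectrum_iff_resolvent[of "inverse z" a] by simp
  next
    case False
    then show ?thesis
      using that n1 by (intro neumann(1)) (simp add: norm_scaleC)
  qed
  have "uniformly_continuous_on (cball 0 1) (\<lambda>z. inverse_of (1 - scaleC z a))"
    by (intro compact_uniformly_continuous continuous_on_resolvent inv) auto
  then obtain d where d: "d > 0"
    "\<And>z w. cmod z \<le> 1 \<Longrightarrow> cmod w \<le> 1 \<Longrightarrow> cmod (z - w) < d \<Longrightarrow>
      norm (inverse_of (1 - scaleC z a) - inverse_of (1 - scaleC w a)) < 1/6"
    unfolding uniformly_continuous_on_def dist_norm
    by (metis dist_0_norm divide_pos_pos mem_cball zero_less_numeral zero_less_one)
  define t where "t = 1 - min (d/2) (1/2)"
  have t: "0 \<le> t" "t < 1" "1 - t < d"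
    using d(1) by (auto simp: t_def)
  have close: "norm (inverse_of (1 - scaleC z a) - inverse_of (1 - scaleC (of_real t * z) a)) \<le> 1/6"
    if "cmod z = 1" for z
  proof (rule less_imp_le, rule d(2))
    have "z - of_real t * z = of_real (1 - t) * z"
      by (simp add: algebra_simps)
    then show "cmod (z - of_real t * z) < d"
      using t that by (simp add: norm_mult del: of_real_diff)
  qed (use t that in \<open>auto simp: norm_mult\<close>)
  \<comment> \<open>With \<open>t ^ N < 1/7\<close> the inverse of \<open>1 - v\<close> is within \<open>1/6\<close> of \<open>1\<close>, so \<open>r\<close> is within \<open>1/3\<close> of \<open>1\<close> and its inverse \<open>1 - u\<close> within \<open>1/2\<close>.\<close>
  obtain m where m: "t ^ m < 1/7"
    using real_arch_pow_inv[of "1/7" t] t by auto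
  define N :: nat where "N = 2 ^ m"
  have "t ^ N \<le> t ^ m"
    using t by (intro power_decreasing) (auto simp: N_def less_imp_le)
  then have tN: "t ^ N < 1/7"
    using m by simp
  define u where "u = a ^ N"
  have nu: "norm u = 1"
    unfolding u_def N_def by (simp add: norm_power_2power_self_adjoint[OF sa] n1)
  define r where "r = inverse_of (1 - u)"
  define v where "v = scaleC (of_real t ^ N) u"
  have avg: "1 - u \<in> units" "norm (r - inverse_of (1 - v)) \<le> 1/6"
    using averaged_resolvent[of a t "1/6" 1 m, OF inv close] t
    by (simp_all add: r_def u_def v_def N_def)
  have nv: "norm v = t ^ N"
    using t by (simp add: v_def norm_scaleC nu norm_power)
  have "norm (inverse_of (1 - v) - 1) \<le> t ^ N / (1 - t ^ N)"
    using neumann(2)[of v] tN by (simp add: nv)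
  also have "\<dots> < 1/6"
    using tN by (simp add: field_simps)
  finally have "norm (r - 1) < 1/3"
    using avg(2) norm_triangle_ineq[of "r - inverse_of (1 - v)" "inverse_of (1 - v) - 1"] by simp
  then have small: "norm (1 - r) < 1/3"
    by (simp add: norm_minus_commute)
  have "inverse_of (1 - (1 - r)) = 1 - u"
    using inverse_of_units[OF avg(1)] by (intro inverse_of_eqI) (simp_all add: r_def)
  then have "norm u \<le> norm (1 - r) / (1 - norm (1 - r))"
    using neumann(2)[of "1 - r"] small by simp
  also have "\<dots> < 1"
    using small by (simp add: field_simps)
  finally show False
    using nu by simp
qed

text \<open>
  Rescaling reduces this to norm \<open>1\<close>, where the unimodular point of the spectrum is real.
\<close>

lemma norm_attained_on_spectrum:
  fixes a :: "'a::cstar_algebra"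
  assumes sa: "adj a = a"
  obtains t where "t \<in> real_spectrum a" "\<bar>t\<bar> = norm a"
proof (cases "a = 0")
  case True
  have "(0::'a) \<notin> units"
    by (simp add: units_iff)
  then have "0 \<in> real_spectrum a"
    using True by (simp add: real_spectrum_def zero_spectrum_iff)
  then show ?thesis
    using that True by simp
next
  case False
  define b where "b = (1 / norm a) *\<^sub>R a"
  have ab: "a = norm a *\<^sub>R b"
    using False by (simp add: b_def)
  obtain z where z: "cmod z = 1" "z \<in> spectrum b"
    using self_adjoint_norm_one_spectrum[of b] False by (auto simp: b_def sa)
  obtain s where s: "z = of_real s"
    using spectrum_self_adjointE[of b z] z sa by (auto simp: b_def)
  have "of_real (norm a) * z \<in> spectrum a"
    using spectrum_scaleR[of "norm a" z b] z False by (simp flip: ab)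
  then show ?thesis
    using that[of "norm a * s"] z(1) by (simp add: s real_spectrum_def abs_mult)
qed

lemma real_spectrum_nonempty:
  fixes a :: "'a::cstar_algebra"
  assumes "adj a = a"
  shows "real_spectrum a \<noteq> {}"
  using norm_attained_on_spectrum[OF assms] by blast

lemma real_spectrum_norm_le: "t \<in> real_spectrum a \<Longrightarrow> \<bar>t\<bar> \<le> norm (a :: 'a::cstar_algebra)"
  using spectrum_norm_le[of "of_real t" a] by (simp add: real_spectrum_def)

lemma norm_le_iff_spectrum:
  fixes a :: "'a::cstar_algebra"
  assumes "adj a = a"
  shows "norm a \<le> c \<longleftrightarrow> (\<forall>t\<in>real_spectrum a. \<bar>t\<bar> \<le> c)"
  by (metis norm_attained_on_spectrum[OF assms] order_trans real_spectrum_norm_le)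

section \<open>Polynomial functional calculus\<close>

lemma poly_at_pCons: "poly_at (pCons c p) a = c *\<^sub>R 1 + a * poly_at p (a :: 'a::cstar_algebra)"
proof (cases "p = 0")
  case False
  then show ?thesis
    by (simp add: poly_at_def sum.atMost_Suc_shift sum_distrib_left del: sum.atMost_Suc)
qed (auto simp: poly_at_def)

lemma poly_at_0 [simp]: "poly_at 0 a = (0 :: 'a::cstar_algebra)"
  by (simp add: poly_at_def)

lemma poly_at_add: "poly_at (p + q) a = poly_at p a + poly_at q (a :: 'a::cstar_algebra)"
  by (induction p q rule: poly_induct2) (simp_all add: poly_at_pCons algebra_simps)

lemma poly_at_smult: "poly_at (smult c p) a = c *\<^sub>R poly_at p (a :: 'a::cstar_algebra)"
  by (induction p) (simp_all add: poly_at_pCons algebra_simps)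

lemma poly_at_mult: "poly_at (p * q) a = poly_at p a * poly_at q (a :: 'a::cstar_algebra)"
  by (induction p) (simp_all add: poly_at_pCons poly_at_add poly_at_smult algebra_simps)

lemma poly_at_diff: "poly_at (p - q) a = poly_at p a - poly_at q (a :: 'a::cstar_algebra)"
proof -
  have "poly_at (- q) a = - poly_at q a"
    by (induction q) (simp_all add: poly_at_pCons)
  then show ?thesis
    using poly_at_add[of p "- q" a] by simp
qed

lemma adj_poly_at:
  fixes a :: "'a::cstar_algebra"
  assumes "adj a = a"
  shows "adj (poly_at p a) = poly_at p a"
proof (induction p)
  case (pCons c p)
  have "poly_at p a * a = a * poly_at p a"
    using poly_at_mult[of p "[:0,1:]" a] poly_at_mult[of "[:0,1:]" p a]
    by (simp add: poly_at_pCons)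
  then show ?case
    using pCons by (simp add: poly_at_pCons adj_add adj_mult assms)
qed simp

text \<open>
  The converse half of the spectral mapping theorem needs all roots of a real polynomial, hence
  evaluation of complex polynomials.
\<close>

definition cpoly_at :: "complex poly \<Rightarrow> 'a::cstar_algebra \<Rightarrow> 'a" where
  "cpoly_at p a = (\<Sum>i\<le>degree p. scaleC (coeff p i) (a ^ i))"

lemma cpoly_at_pCons: "cpoly_at (pCons c p) a = scaleC c 1 + a * cpoly_at p (a :: 'a::cstar_algebra)"
proof (cases "p = 0")
  case False
  then show ?thesis
    by (simp add: cpoly_at_def sum.atMost_Suc_shift sum_distrib_left mult_scaleC_right
        del: sum.atMost_Suc)
qed (auto simp: cpoly_at_def)

lemma cpoly_at_0 [simp]: "cpoly_at 0 a = (0 :: 'a::cstar_algebra)"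
  by (simp add: cpoly_at_def)

lemma cpoly_at_linear_mult:
  "cpoly_at ([:- z, 1:] * q) a = (a - scaleC z 1) * cpoly_at q (a :: 'a::cstar_algebra)"
proof -
  have add: "cpoly_at (p + q) a = cpoly_at p a + cpoly_at q a" for p q
    by (induction p q rule: poly_induct2) (simp_all add: cpoly_at_pCons algebra_simps scaleC_add_left)
  have smult: "cpoly_at (smult c p) a = scaleC c (cpoly_at p a)" for c p
    by (induction p)
      (simp_all add: cpoly_at_pCons algebra_simps scaleC_add_right scaleC_scaleC mult_scaleC_right)
  have "[:- z, 1:] * q = smult (- z) q + pCons 0 q"
    by simp
  then show ?thesis
    by (simp only: add smult cpoly_at_pCons)
      (simp add: algebra_simps mult_scaleC_left scaleC_minus_left)
qed

lemma cpoly_at_of_real: "cpoly_at (map_poly of_real p) a = poly_at p (a :: 'a::cstar_algebra)"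
  by (induction p) (simp_all add: map_poly_pCons cpoly_at_pCons poly_at_pCons scaleC_of_real)

lemma poly_of_real: "poly (map_poly of_real p) (of_real x) = complex_of_real (poly p x)"
  by (induction p) (simp_all add: map_poly_pCons)

text \<open>Splitting \<open>p\<close> into linear factors, each of which is invertible at \<open>a\<close>.\<close>

lemma cpoly_at_units:
  fixes a :: "'a::cstar_algebra"
  assumes "\<And>z. z \<in> spectrum a \<Longrightarrow> poly p z \<noteq> 0" and "spectrum a \<noteq> {}"
  shows "cpoly_at p a \<in> units"
  using assms(1)
proof (induction "degree p" arbitrary: p)
  case 0
  then obtain c where c: "p = [:c:]"
    by (metis degree_eq_zeroE)
  \<comment> \<open>A nonempty spectrum excludes the zero polynomial.\<close>
  have "c \<noteq> 0"
    using 0 assms(2) c by auto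
  then show ?case
    by (simp add: c cpoly_at_pCons units_scaleC units_one)
next
  case (Suc n)
  have "\<not> constant (poly p)"
    using Suc(2) by (simp add: constant_degree)
  then obtain z where z: "poly p z = 0"
    using fundamental_theorem_of_algebra by blast
  define q where "q = synthetic_div p z"
  have p: "p = [:- z, 1:] * q"
    using synthetic_div_correct'[of z p] z by (simp add: q_def)
  have "cpoly_at q a \<in> units"
  proof (rule Suc(1))
    show "n = degree q"
      using Suc(2) by (simp add: q_def degree_synthetic_div)
    show "poly q w \<noteq> 0" if "w \<in> spectrum a" for w
      using Suc(3)[OF that] by (subst (asm) p) auto
  qed
  moreover have "z \<notin> spectrum a"
    using Suc(3) z by blast
  then have "a - scaleC z 1 \<in> units"
    by (simp add: spectrum_def)
  ultimately show ?case
    unfolding p cpoly_at_linear_mult by (intro units_mult)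
qed

text \<open>
  If \<open>p(t) = s\<close> then \<open>a - t\<close> divides \<open>p(a) - s\<close>, and a factor of an invertible element that commutes
  with its cofactor is invertible. Conversely, if \<open>p\<close> omits the value \<open>s\<close> on the spectrum, then
  \<open>p(a) - s\<close> is invertible by \<open>cpoly_at_units\<close>.
\<close>

lemma real_spectrum_poly_at:
  fixes a :: "'a::cstar_algebra"
  assumes sa: "adj a = a"
  shows "real_spectrum (poly_at p a) = poly p ` real_spectrum a"
proof (intro equalityI subsetI)
  fix s assume s: "s \<in> real_spectrum (poly_at p a)"
  show "s \<in> poly p ` real_spectrum a"
  proof (rule ccontr)
    assume *: "s \<notin> poly p ` real_spectrum a"
    define q where "q = p - [:s:]"
    have "poly_at q a = poly_at p a - scaleC (of_real s) 1"
      by (simp add: q_def poly_at_diff poly_at_pCons scaleC_of_real)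
    moreover have "cpoly_at (map_poly of_real q) a \<in> units"
    proof (rule cpoly_at_units)
      show "spectrum a \<noteq> {}"
        using real_spectrum_nonempty[OF sa] by (auto simp: real_spectrum_def)
      show "poly (map_poly of_real q) z \<noteq> 0" if z: "z \<in> spectrum a" for z
      proof -
        obtain t where t: "z = of_real t" "t \<in> real_spectrum a"
          using spectrum_self_adjointE[OF sa z] .
        then have "poly q t \<noteq> 0"
          using * by (auto simp: q_def image_iff)
        then show ?thesis
          by (simp add: t poly_of_real)
      qed
    qed
    ultimately show False
      using s by (simp add: cpoly_at_of_real real_spectrum_def spectrum_def)
  qed
next
  fix s assume "s \<in> poly p ` real_spectrum a"
  then obtain t where t: "s = poly p t" "t \<in> real_spectrum a"
    by auto
  define q where "q = synthetic_div p t"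
  have "p - [:s:] = [:- t, 1:] * q"
    using synthetic_div_correct'[of t p] by (simp add: q_def t(1) algebra_simps)
  then have eq: "poly_at p a - scaleC (of_real s) 1 = (a - scaleC (of_real t) 1) * poly_at q a"
    "poly_at p a - scaleC (of_real s) 1 = poly_at q a * (a - scaleC (of_real t) 1)"
    using poly_at_mult[of "[:- t, 1:]" q a] poly_at_mult[of q "[:- t, 1:]" a]
      poly_at_diff[of p "[:s:]" a]
    by (simp_all add: poly_at_pCons scaleC_of_real mult.commute del: mult_pCons_left mult_pCons_right)
  show "s \<in> real_spectrum (poly_at p a)"
  proof (rule ccontr)
    assume "s \<notin> real_spectrum (poly_at p a)"
    then have "poly_at p a - scaleC (of_real s) 1 \<in> units"
      by (simp add: real_spectrum_def spectrum_def)
    then have "a - scaleC (of_real t) 1 \<in> units"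
      using eq units_factor by metis
    then show False
      using t(2) by (simp add: real_spectrum_def spectrum_def)
  qed
qed

lemma norm_poly_at_le_iff:
  fixes a :: "'a::cstar_algebra"
  assumes "adj a = a"
  shows "norm (poly_at p a) \<le> c \<longleftrightarrow> (\<forall>t\<in>real_spectrum a. \<bar>poly p t\<bar> \<le> c)"
  by (simp add: norm_le_iff_spectrum adj_poly_at real_spectrum_poly_at assms)

section \<open>Continuous functional calculus\<close>

text \<open>
  The functions to which the limit defining \<open>cfc\<close> applies. Approximation is only required on the
  spectrum, so that no common domain has to be chosen when
  functions are multiplied.
\<close>

definition approximable :: "(real \<Rightarrow> real) \<Rightarrow> 'a::cstar_algebra \<Rightarrow> bool" where
  "approximable f a \<longleftrightarrow>
    (\<exists>p. uniform_limit (real_spectrum a) (\<lambda>n x. poly (p n) x) f sequentially)"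

lemma approximable_poly: "approximable (poly p) a"
  unfolding approximable_def by (rule exI[of _ "\<lambda>_. p"]) (simp add: uniform_limit_const)

lemma approximable_continuous:
  fixes a :: "'a::cstar_algebra"
  assumes "continuous_on {l..u} f" "real_spectrum a \<subseteq> {l..u}"
  shows "approximable f a"
proof -
  have "\<exists>p. \<forall>x\<in>{l..u}. \<bar>f x - poly p x\<bar> < e" if e: "e > 0" for e :: real
  proof -
    obtain g where g: "real_polynomial_function g" "\<And>x. x \<in> {l..u} \<Longrightarrow> \<bar>f x - g x\<bar> < e"
      using Stone_Weierstrass_real_polynomial_function[OF compact_Icc assms(1) e] by blast
    then obtain c n where "g = (\<lambda>x. \<Sum>i\<le>n. c i * x ^ i)"
      by (auto simp: real_polynomial_function_iff_sum)
    then have "g = poly (\<Sum>i\<le>n. monom (c i) i)"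
      by (auto simp: poly_sum poly_monom)
    then show ?thesis
      using g(2) by blast
  qed
  then obtain p where p: "\<And>e x. e > 0 \<Longrightarrow> x \<in> {l..u} \<Longrightarrow> \<bar>f x - poly (p e) x\<bar> < e"
    by metis
  have "uniform_limit (real_spectrum a) (\<lambda>n x. poly (p (1 / real (Suc n))) x) f sequentially"
    unfolding uniform_limit_iff eventually_sequentially
  proof safe
    fix e :: real assume "e > 0"
    then obtain N where N: "1 / real (Suc N) < e"
      by (metis nat_approx_posE)
    have "dist (poly (p (1 / real (Suc n))) x) (f x) < e"
      if "n \<ge> N" "x \<in> real_spectrum a" for n x
    proof -
      have "1 / real (Suc n) \<le> 1 / real (Suc N)"
        using that(1) by (intro divide_left_mono) auto
      moreover have "\<bar>f x - poly (p (1 / real (Suc n))) x\<bar> < 1 / real (Suc n)"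
        using that(2) assms(2) by (intro p) auto
      ultimately show ?thesis
        using N by (simp add: dist_real_def abs_minus_commute)
    qed
    then show "\<exists>N. \<forall>n\<ge>N. \<forall>x\<in>real_spectrum a. dist (poly (p (1 / real (Suc n))) x) (f x) < e"
      by blast
  qed
  then show ?thesis
    unfolding approximable_def by (rule exI[of _ "\<lambda>n. p (1 / real (Suc n))"])
qed

lemma approximable_continuous_UNIV:
  fixes a :: "'a::cstar_algebra"
  assumes "continuous_on UNIV f"
  shows "approximable f a"
proof (rule approximable_continuous)
  show "continuous_on {- norm a..norm a} f"
    by (rule continuous_on_subset[OF assms]) simp
  show "real_spectrum a \<subseteq> {- norm a..norm a}"
    using real_spectrum_norm_le[of _ a] by (auto simp: abs_le_iff minus_le_iff)
qed

lemma poly_at_diff_eventually_small: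
  fixes a :: "'a::cstar_algebra"
  assumes sa: "adj a = a" and "e > 0"
    and p: "uniform_limit (real_spectrum a) (\<lambda>n x. poly (p n) x) f sequentially"
    and q: "uniform_limit (real_spectrum a) (\<lambda>n x. poly (q n) x) f sequentially"
  shows "\<exists>N. \<forall>m\<ge>N. \<forall>n\<ge>N. norm (poly_at (p m) a - poly_at (q n) a) \<le> e"
proof -
  obtain M where M: "\<And>n x. n \<ge> M \<Longrightarrow> x \<in> real_spectrum a \<Longrightarrow> dist (poly (p n) x) (f x) < e/2"
    using p \<open>e > 0\<close> unfolding uniform_limit_iff eventually_sequentially
    by (metis half_gt_zero)
  obtain N where N: "\<And>n x. n \<ge> N \<Longrightarrow> x \<in> real_spectrum a \<Longrightarrow> dist (poly (q n) x) (f x) < e/2"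
    using q \<open>e > 0\<close> unfolding uniform_limit_iff eventually_sequentially
    by (metis half_gt_zero)
  have "norm (poly_at (p m) a - poly_at (q n) a) \<le> e" if "m \<ge> max M N" "n \<ge> max M N" for m n
    unfolding poly_at_diff[symmetric] norm_poly_at_le_iff[OF sa]
  proof
    fix x assume "x \<in> real_spectrum a"
    then have "\<bar>poly (p m) x - f x\<bar> < e/2" "\<bar>poly (q n) x - f x\<bar> < e/2"
      using M[of m x] N[of n x] that by (simp_all add: dist_real_def)
    then show "\<bar>poly (p m - q n) x\<bar> \<le> e"
      unfolding poly_diff by linarith
  qed
  then show ?thesis
    by blast
qed

text \<open>
  Polynomials that are uniformly close on the spectrum are close in norm at \<open>a\<close>. Hence the
  approximating sequence is Cauchy, and all approximating sequences have the same limit.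
\<close>

lemma cfc_tendsto:
  fixes a :: "'a::cstar_algebra"
  assumes sa: "adj a = a"
    and p: "uniform_limit (real_spectrum a) (\<lambda>n x. poly (p n) x) f sequentially"
  shows "(\<lambda>n. poly_at (p n) a) \<longlonglongrightarrow> cfc f a"
proof -
  have "Cauchy (\<lambda>n. poly_at (p n) a)"
  proof (rule CauchyI)
    fix e :: real assume "e > 0"
    then obtain N where "\<forall>m\<ge>N. \<forall>n\<ge>N. norm (poly_at (p m) a - poly_at (p n) a) \<le> e/2"
      using poly_at_diff_eventually_small[OF sa _ p p, of "e/2"] by auto
    then show "\<exists>N. \<forall>m\<ge>N. \<forall>n\<ge>N. norm (poly_at (p m) a - poly_at (p n) a) < e"
      using \<open>e > 0\<close> by (metis field_sum_of_halves half_gt_zero less_add_same_cancel1 order_le_less_trans)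
  qed
  then obtain b where b: "(\<lambda>n. poly_at (p n) a) \<longlonglongrightarrow> b"
    using Cauchy_convergent_iff convergent_def by blast
  have all: "(\<lambda>n. poly_at (q n) a) \<longlonglongrightarrow> b"
    if q: "uniform_limit (real_spectrum a) (\<lambda>n x. poly (q n) x) f sequentially" for q
  proof -
    have "(\<lambda>n. poly_at (q n) a - poly_at (p n) a) \<longlonglongrightarrow> 0"
    proof (rule LIMSEQ_I)
      fix e :: real assume "e > 0"
      then obtain N where "\<forall>m\<ge>N. \<forall>n\<ge>N. norm (poly_at (q m) a - poly_at (p n) a) \<le> e/2"
        using poly_at_diff_eventually_small[OF sa _ q p, of "e/2"] by auto
      then show "\<exists>N. \<forall>n\<ge>N. norm (poly_at (q n) a - poly_at (p n) a - 0) < e"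
        using \<open>e > 0\<close> by (metis diff_zero field_sum_of_halves half_gt_zero less_add_same_cancel1 order_le_less_trans)
    qed
    from tendsto_add[OF this b] show ?thesis
      by simp
  qed
  have "cfc f a = b"
    unfolding cfc_def
  proof (rule the_equality)
    fix b' assume "\<forall>p. uniform_limit (real_spectrum a) (\<lambda>n. poly (p n)) f sequentially
        \<longrightarrow> (\<lambda>n. poly_at (p n) a) \<longlonglongrightarrow> b'"
    then show "b' = b"
      using p b LIMSEQ_unique by blast
  qed (use all in blast)
  then show ?thesis
    using b by simp
qed

lemma cfc_cong:
  assumes "\<And>t. t \<in> real_spectrum a \<Longrightarrow> f t = g t"
  shows "cfc f a = cfc g a"
proof -
  have "uniform_limit (real_spectrum a) p f F \<longleftrightarrow> uniform_limit (real_spectrum a) p g F"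
    for p and F :: "nat filter"
    using assms by (intro uniform_limit_cong) auto
  then show ?thesis
    by (simp add: cfc_def)
qed

lemma cfc_poly:
  fixes a :: "'a::cstar_algebra"
  assumes "adj a = a"
  shows "cfc (poly p) a = poly_at p a"
proof -
  have "uniform_limit (real_spectrum a) (\<lambda>n::nat. poly p) (poly p) sequentially"
    by (simp add: uniform_limit_const)
  from cfc_tendsto[OF assms, of "\<lambda>_. p", OF this] show ?thesis
    by (simp add: LIMSEQ_const_iff)
qed

lemma cfc_const:
  fixes a :: "'a::cstar_algebra"
  assumes "adj a = a"
  shows "cfc (\<lambda>_. c) a = c *\<^sub>R 1" "approximable (\<lambda>_. c) a"
proof -
  have "(\<lambda>_. c) = poly [:c:]"
    by auto
  then show "cfc (\<lambda>_. c) a = c *\<^sub>R 1" "approximable (\<lambda>_. c) a"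
    using approximable_poly[of "[:c:]" a] by (simp_all add: cfc_poly assms poly_at_pCons)
qed

lemma cfc_id:
  fixes a :: "'a::cstar_algebra"
  assumes "adj a = a"
  shows "cfc (\<lambda>t. t) a = a" "approximable (\<lambda>t. t) a"
proof -
  have "(\<lambda>t. t) = poly [:0, 1 :: real:]"
    by auto
  then show "cfc (\<lambda>t. t) a = a" "approximable (\<lambda>t. t) a"
    using approximable_poly[of "[:0, 1:]" a] by (simp_all add: cfc_poly assms poly_at_pCons)
qed

lemma adj_cfc:
  fixes a :: "'a::cstar_algebra"
  assumes sa: "adj a = a" and f: "approximable f a"
  shows "adj (cfc f a) = cfc f a"
proof -
  obtain p where p: "uniform_limit (real_spectrum a) (\<lambda>n x. poly (p n) x) f sequentially"
    using f approximable_def by blast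
  have "(\<lambda>n. adj (poly_at (p n) a)) \<longlonglongrightarrow> adj (cfc f a)"
    by (intro tendsto_adj cfc_tendsto[OF sa p])
  then show ?thesis
    using cfc_tendsto[OF sa p] by (simp add: adj_poly_at[OF sa] LIMSEQ_unique)
qed

lemma norm_cfc_le_iff:
  fixes a :: "'a::cstar_algebra"
  assumes sa: "adj a = a" and f: "approximable f a"
  shows "norm (cfc f a) \<le> c \<longleftrightarrow> (\<forall>t\<in>real_spectrum a. \<bar>f t\<bar> \<le> c)"
proof
  obtain p where p: "uniform_limit (real_spectrum a) (\<lambda>n x. poly (p n) x) f sequentially"
    using f approximable_def by blast
  have lim: "(\<lambda>n. norm (poly_at (p n) a)) \<longlonglongrightarrow> norm (cfc f a)"
    by (intro tendsto_norm cfc_tendsto[OF sa p])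
  show "\<forall>t\<in>real_spectrum a. \<bar>f t\<bar> \<le> c" if "norm (cfc f a) \<le> c"
  proof
    fix t assume t: "t \<in> real_spectrum a"
    have "(\<lambda>n. \<bar>poly (p n) t\<bar>) \<longlonglongrightarrow> \<bar>f t\<bar>"
      by (intro tendsto_rabs tendsto_uniform_limitI[OF p t])
    moreover have "\<bar>poly (p n) t\<bar> \<le> norm (poly_at (p n) a)" for n
      using norm_poly_at_le_iff[OF sa, of "p n" "norm (poly_at (p n) a)"] t by blast
    ultimately have "\<bar>f t\<bar> \<le> norm (cfc f a)"
      using lim by (intro LIMSEQ_le) auto
    then show "\<bar>f t\<bar> \<le> c"
      using that by linarith
  qed
  show "norm (cfc f a) \<le> c" if c: "\<forall>t\<in>real_spectrum a. \<bar>f t\<bar> \<le> c"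
  proof (rule field_le_epsilon)
    fix e :: real assume "e > 0"
    then obtain N where N: "\<And>n x. n \<ge> N \<Longrightarrow> x \<in> real_spectrum a \<Longrightarrow> dist (poly (p n) x) (f x) < e"
      using p unfolding uniform_limit_iff eventually_sequentially by metis
    have "norm (poly_at (p n) a) \<le> c + e" if "n \<ge> N" for n
      unfolding norm_poly_at_le_iff[OF sa]
    proof
      fix t assume t: "t \<in> real_spectrum a"
      have "\<bar>f t\<bar> \<le> c"
        using c t by blast
      then show "\<bar>poly (p n) t\<bar> \<le> c + e"
        using N[OF that t] by (auto simp: dist_real_def)
    qed
    then show "norm (cfc f a) \<le> c + e"
      by (intro LIMSEQ_le_const2[OF lim]) blast
  qed
qed

lemma cfc_mult:
  fixes a :: "'a::cstar_algebra"
  assumes sa: "adj a = a" and f: "approximable f a" and g: "approximable g a"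
  shows "cfc (\<lambda>t. f t * g t) a = cfc f a * cfc g a" "approximable (\<lambda>t. f t * g t) a"
proof -
  obtain p where p: "uniform_limit (real_spectrum a) (\<lambda>n x. poly (p n) x) f sequentially"
    using f approximable_def by blast
  obtain q where q: "uniform_limit (real_spectrum a) (\<lambda>n x. poly (q n) x) g sequentially"
    using g approximable_def by blast
  have bd: "bounded (h ` real_spectrum a)" if "approximable h a" for h
    using norm_cfc_le_iff[OF sa that, of "norm (cfc h a)"]
    by (auto simp: bounded_iff)
  have pq: "uniform_limit (real_spectrum a) (\<lambda>n x. poly (p n * q n) x) (\<lambda>t. f t * g t) sequentially"
    unfolding poly_mult by (intro uniform_lim_mult p q bd f g)
  then show "approximable (\<lambda>t. f t * g t) a"
    unfolding approximable_def by (intro exI[of _ "\<lambda>n. p n * q n"])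
  have "(\<lambda>n. poly_at (p n * q n) a) \<longlonglongrightarrow> cfc f a * cfc g a"
    unfolding poly_at_mult by (intro tendsto_mult cfc_tendsto[OF sa] p q)
  then show "cfc (\<lambda>t. f t * g t) a = cfc f a * cfc g a"
    using cfc_tendsto[OF sa, of "\<lambda>n. p n * q n", OF pq] LIMSEQ_unique by blast
qed

section \<open>Positive elements\<close>

lemma positive_iff:
  "is_positive a \<longleftrightarrow> adj a = a \<and> (\<forall>t\<in>real_spectrum a. 0 \<le> t)" for a :: "'a::cstar_algebra"
proof (cases "adj a = a")
  case sa: True
  show ?thesis
  proof
    assume "is_positive a"
    then show "adj a = a \<and> (\<forall>t\<in>real_spectrum a. 0 \<le> t)"
      by (auto simp: is_positive_def real_spectrum_def dest: subsetD)
  next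
    assume "adj a = a \<and> (\<forall>t\<in>real_spectrum a. 0 \<le> t)"
    then show "is_positive a"
      using spectrum_self_adjointE[OF sa] unfolding is_positive_def
      by (metis atLeast_iff image_eqI subsetI)
  qed
qed (simp add: is_positive_def)

lemma real_spectrum_shift: "s \<in> real_spectrum (t *\<^sub>R 1 - a) \<longleftrightarrow> t - s \<in> real_spectrum a"
  using spectrum_real_shift[of "of_real s" t a] by (simp add: real_spectrum_def)

lemma real_spectrum_minus: "s \<in> real_spectrum (- a) \<longleftrightarrow> - s \<in> real_spectrum a"
  using spectrum_minus[of "of_real s" a] by (simp add: real_spectrum_def)

text \<open>
  Positivity of a self-adjoint element is expressed through norms: the spectrum lies in \<open>[0, 2 t]\<close>
  exactly if \<open>\<parallel>t - a\<parallel> \<le> t\<close>. In this form the triangle inequality shows that sums of positive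
  elements are positive.
\<close>

lemma positive_norm_shift_le:
  fixes a :: "'a::cstar_algebra"
  assumes "is_positive a"
  shows "norm (norm a *\<^sub>R 1 - a) \<le> norm a"
proof -
  have "adj (norm a *\<^sub>R 1 - a) = norm a *\<^sub>R 1 - a"
    using assms by (simp add: adj_diff positive_iff)
  moreover have "\<bar>t\<bar> \<le> norm a" if "t \<in> real_spectrum (norm a *\<^sub>R 1 - a)" for t
  proof -
    have t: "norm a - t \<in> real_spectrum a"
      using that by (simp add: real_spectrum_shift)
    then have "0 \<le> norm a - t"
      using assms positive_iff by blast
    then show ?thesis
      using real_spectrum_norm_le[OF t] by linarith
  qed
  ultimately show ?thesis
    using norm_le_iff_spectrum by blast
qed

lemma positiveI_norm_shift_le:
  fixes a :: "'a::cstar_algebra"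
  assumes "adj a = a" "norm (t *\<^sub>R 1 - a) \<le> t"
  shows "is_positive a"
proof -
  have "0 \<le> s" if "s \<in> real_spectrum a" for s
  proof -
    have "t - s \<in> real_spectrum (t *\<^sub>R 1 - a)"
      using that by (simp add: real_spectrum_shift)
    then have "\<bar>t - s\<bar> \<le> t"
      using real_spectrum_norm_le assms(2) order_trans by blast
    then show ?thesis
      by linarith
  qed
  then show ?thesis
    using assms(1) positive_iff by blast
qed

lemma positive_add:
  fixes a b :: "'a::cstar_algebra"
  assumes "is_positive a" "is_positive b"
  shows "is_positive (a + b)"
proof (rule positiveI_norm_shift_le)
  show "adj (a + b) = a + b"
    using assms by (simp add: adj_add positive_iff)
  have "(norm a + norm b) *\<^sub>R 1 - (a + b) = (norm a *\<^sub>R 1 - a) + (norm b *\<^sub>R 1 - b)"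
    by (simp add: scaleR_add_left)
  also have "norm \<dots> \<le> norm a + norm b"
    by (intro norm_triangle_le add_mono positive_norm_shift_le assms)
  finally show "norm ((norm a + norm b) *\<^sub>R 1 - (a + b)) \<le> norm a + norm b" .
qed

lemma positive_square:
  fixes a :: "'a::cstar_algebra"
  assumes "adj a = a"
  shows "is_positive (a * a)"
proof -
  have "poly_at [:0, 0, 1:] a = a * a"
    by (simp add: poly_at_pCons)
  then have "real_spectrum (a * a) = (\<lambda>t. t * t) ` real_spectrum a"
    using real_spectrum_poly_at[OF assms, of "[:0, 0, 1:]"] by simp
  then show ?thesis
    by (auto simp: positive_iff adj_mult assms)
qed

lemma positive_minus_positive_imp_zero:
  fixes a :: "'a::cstar_algebra"
  assumes "is_positive a" "is_positive (- a)"
  shows "a = 0"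
proof -
  obtain t where t: "t \<in> real_spectrum a" "\<bar>t\<bar> = norm a"
    using norm_attained_on_spectrum assms(1) positive_iff by blast
  have "0 \<le> t"
    using assms(1) t(1) positive_iff by blast
  moreover have "- t \<in> real_spectrum (- a)"
    using t(1) by (simp add: real_spectrum_minus)
  then have "0 \<le> - t"
    using assms(2) positive_iff by blast
  ultimately show ?thesis
    using t(2) by simp
qed

text \<open>
  The spectra of \<open>y\<^sup>* y\<close> and \<open>y y\<^sup>*\<close> agree outside \<open>0\<close>, so both elements are negative. But their sum is
  \<open>(h\<^sup>2 + k\<^sup>2) / 2\<close> with the self-adjoint elements \<open>h = y + y\<^sup>*\<close> and \<open>k = i (y - y\<^sup>*)\<close>, and is positive. Thus
  \<open>y\<^sup>* y\<close> is positive as well as negative.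
\<close>

lemma adj_mult_self_negative_imp_zero:
  fixes y :: "'a::cstar_algebra"
  assumes neg: "is_positive (- (adj y * y))"
  shows "adj y * y = 0"
proof -
  have neg': "is_positive (- (y * adj y))"
    unfolding positive_iff
  proof safe
    show "adj (- (y * adj y)) = - (y * adj y)"
      by (simp add: adj_minus adj_mult adj_adj)
    fix t assume t: "t \<in> real_spectrum (- (y * adj y))"
    show "0 \<le> t"
    proof (cases "t = 0")
      case False
      have "of_real t \<in> spectrum ((- y) * adj y)"
        using t by (simp add: real_spectrum_def)
      then have "of_real t \<in> spectrum (adj y * (- y))"
        by (rule spectrum_mult_commute) (use False in simp)
      then show ?thesis
        using neg by (simp add: positive_iff real_spectrum_def)
    qed simp
  qed
  define h where "h = y + adj y"
  define k where "k = scaleC \<i> (y - adj y)"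
  have sa: "adj h = h" "adj k = k"
    by (simp_all add: h_def k_def adj_add adj_scaleC adj_diff adj_adj add.commute
        scaleC_minus_left flip: scaleC_minus_right)
  have "k * k = - ((y - adj y) * (y - adj y))"
    by (simp add: k_def mult_scaleC_left mult_scaleC_right scaleC_scaleC scaleC_minus_left)
  then have sum: "h * h + k * k + (- (y * adj y) + - (y * adj y)) + - (adj y * y) = adj y * y"
    by (simp add: h_def algebra_simps)
  have "is_positive (h * h + k * k + (- (y * adj y) + - (y * adj y)) + - (adj y * y))"
    by (intro positive_add positive_square sa neg neg')
  then show ?thesis
    unfolding sum using neg by (rule positive_minus_positive_imp_zero)
qed

text \<open>
  For \<open>b = x\<^sup>* x\<close> with negative part \<open>m(b)\<close>, the element \<open>y = x m(b)\<^sup>1\<^sup>/\<^sup>2\<close> satisfies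
  \<open>y\<^sup>* y = b m(b) = - m(b)\<^sup>2\<close>. This is negative, hence zero, so \<open>m\<close> vanishes on the spectrum of \<open>b\<close>.
\<close>

lemma adj_mult_self_positive:
  fixes x :: "'a::cstar_algebra"
  shows "is_positive (adj x * x)"
proof -
  define b where "b = adj x * x"
  have sa: "adj b = b"
    by (simp add: b_def adj_mult adj_adj)
  define m where "m t = max (- t) 0" for t :: real
  have [continuous_intros]: "continuous_on UNIV m"
    unfolding m_def by (intro continuous_intros)
  have m: "approximable m b" and s: "approximable (\<lambda>t. sqrt (m t)) b"
    by (intro approximable_continuous_UNIV continuous_intros)+
  note i = cfc_id[OF sa]
  define r where "r = cfc (\<lambda>t. sqrt (m t)) b"
  define k where "k = cfc m b"
  have r: "adj r = r" and k: "adj k = k"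
    unfolding r_def k_def by (intro adj_cfc sa s m)+
  have f: "(\<lambda>t. sqrt (m t) * (t * sqrt (m t))) = (\<lambda>t. (- 1) * (m t * m t))"
  proof
    fix t
    have "sqrt (m t) * sqrt (m t) = m t"
      by (simp add: m_def)
    then have "sqrt (m t) * (t * sqrt (m t)) = t * m t"
      by (metis mult.left_commute)
    also have "\<dots> = (- 1) * (m t * m t)"
      by (auto simp: m_def max_def)
    finally show "sqrt (m t) * (t * sqrt (m t)) = (- 1) * (m t * m t)" .
  qed
  have "adj (x * r) * (x * r) = r * (b * r)"
    by (simp add: adj_mult r b_def mult.assoc)
  also have "\<dots> = cfc (\<lambda>t. sqrt (m t) * (t * sqrt (m t))) b"
    by (simp add: r_def i cfc_mult[OF sa s] cfc_mult[OF sa i(2) s])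
  finally have 1: "adj (x * r) * (x * r) = cfc (\<lambda>t. sqrt (m t) * (t * sqrt (m t))) b" .
  also have "\<dots> = - (k * k)"
    unfolding f using cfc_mult[OF sa cfc_const(2)[OF sa] cfc_mult(2)[OF sa m m], of "- 1"]
    by (simp add: k_def cfc_const[OF sa] cfc_mult[OF sa m m])
  finally have "is_positive (- (adj (x * r) * (x * r)))"
    using positive_square[OF k] by simp
  then have "cfc (\<lambda>t. sqrt (m t) * (t * sqrt (m t))) b = 0"
    using adj_mult_self_negative_imp_zero 1 by metis
  moreover have "approximable (\<lambda>t. sqrt (m t) * (t * sqrt (m t))) b"
    by (intro cfc_mult(2) sa s i)
  ultimately have "\<forall>t\<in>real_spectrum b. \<bar>sqrt (m t) * (t * sqrt (m t))\<bar> \<le> 0"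
    using norm_cfc_le_iff[OF sa] by (metis norm_zero order_refl)
  then have "\<forall>t\<in>real_spectrum b. 0 \<le> t"
    by (auto simp: m_def max_def split: if_splits)
  then show ?thesis
    using sa by (simp add: positive_iff flip: b_def)
qed

section \<open>Positive invertible elements and congruence\<close>

lemma pos_inv_iff:
  "a \<in> pos_inv \<longleftrightarrow> a \<in> units \<and> adj a = a \<and> (\<forall>t\<in>real_spectrum a. 0 < t)" for a :: "'a::cstar_algebra"
proof -
  have "0 \<notin> real_spectrum a" if "a \<in> units"
    using that zero_spectrum_iff[of a] by (simp add: real_spectrum_def)
  then show ?thesis
    unfolding pos_inv_def positive_iff by (auto simp: less_le)
qed

lemma real_spectrum_inverse:
  fixes a :: "'a::cstar_algebra"
  assumes "a \<in> units" "t \<noteq> 0" "t \<in> real_spectrum a"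
  shows "1 / t \<in> real_spectrum (inverse_of a)"
  using spectrum_inverse[of a "of_real t"] assms by (simp add: real_spectrum_def inverse_eq_divide)

text \<open>
  The spectrum stays away from \<open>0\<close>, by at least \<open>1 / \<parallel>a\<^sup>-\<^sup>1\<parallel>\<close>, so continuity on the open half-line
  suffices.
\<close>

lemma approximable_pos_inv:
  fixes a :: "'a::cstar_algebra"
  assumes a: "a \<in> pos_inv" and f: "continuous_on {0<..} f"
  shows "approximable f a"
proof (rule approximable_continuous)
  have u: "a \<in> units"
    using a pos_inv_iff by blast
  define l where "l = 1 / norm (inverse_of a)"
  have "norm (inverse_of a) > 0"
    using norm_units_ge_1[OF u] by (cases "norm (inverse_of a) = 0") auto
  then have "l > 0"
    by (simp add: l_def)
  then show "continuous_on {l..norm a} f"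
    by (intro continuous_on_subset[OF f]) auto
  show "real_spectrum a \<subseteq> {l..norm a}"
  proof
    fix t assume t: "t \<in> real_spectrum a"
    then have "t > 0"
      using a pos_inv_iff by blast
    then have "1 / t \<le> norm (inverse_of a)"
      using real_spectrum_norm_le[OF real_spectrum_inverse[OF u _ t]] by simp
    then have "l \<le> t"
      using \<open>t > 0\<close> \<open>norm (inverse_of a) > 0\<close> by (simp add: l_def field_simps)
    then show "t \<in> {l..norm a}"
      using real_spectrum_norm_le[OF t] by simp
  qed
qed

lemma inv_sqrt:
  fixes a :: "'a::cstar_algebra"
  assumes a: "a \<in> pos_inv"
  shows "adj (inv_sqrt a) = inv_sqrt a" "inv_sqrt a \<in> units"
    "inv_sqrt a * inv_sqrt a = inverse_of a"
proof -
  have sa: "adj a = a"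
    using a pos_inv_iff by blast
  let ?f = "\<lambda>t::real. t powr (- 1/2)"
  define c where "c = inv_sqrt a"
  have f: "approximable ?f a"
    by (rule approximable_pos_inv[OF a]) (auto intro!: continuous_intros)
  note i = cfc_id[OF sa]
  have eq: "?f t * (?f t * t) = 1" "t * (?f t * ?f t) = 1" if "t \<in> real_spectrum a" for t
  proof -
    have "t > 0"
      using that a pos_inv_iff by blast
    then have "?f t * ?f t = 1 / t"
      by (simp add: powr_minus_divide flip: powr_add)
    then show "?f t * (?f t * t) = 1" "t * (?f t * ?f t) = 1"
      using \<open>t > 0\<close> by (simp_all flip: mult.assoc)
  qed
  have "c * (c * a) = cfc (\<lambda>t. ?f t * (?f t * t)) a"
    using cfc_mult[OF sa f cfc_mult(2)[OF sa f i(2)]] cfc_mult(1)[OF sa f i(2)]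
    by (simp add: c_def inv_sqrt_def i)
  also have "\<dots> = 1"
    using cfc_cong[of a, OF eq(1)] cfc_const(1)[OF sa, of 1] by simp
  finally have 1: "c * (c * a) = 1" .
  have "a * (c * c) = cfc (\<lambda>t. t * (?f t * ?f t)) a"
    using cfc_mult[OF sa i(2) cfc_mult(2)[OF sa f f]] cfc_mult(1)[OF sa f f]
    by (simp add: c_def inv_sqrt_def i)
  also have "\<dots> = 1"
    using cfc_cong[of a, OF eq(2)] cfc_const(1)[OF sa, of 1] by simp
  finally have 2: "a * (c * c) = 1" .
  show "adj (inv_sqrt a) = inv_sqrt a"
    unfolding inv_sqrt_def by (rule adj_cfc[OF sa f])
  show "inv_sqrt a \<in> units"
    unfolding c_def[symmetric] using 1 2 by (intro unitsI[of c "c * a" "a * c"]) (simp_all add: mult.assoc)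
  show "inv_sqrt a * inv_sqrt a = inverse_of a"
    unfolding c_def[symmetric] using 1 2 by (intro inverse_of_eqI[symmetric]) (simp_all add: mult.assoc)
qed

lemma act_one: "act g 1 = g * adj g"
  by (simp add: act_def)

lemma act_act: "act g (act h a) = act (g * h) a"
  by (simp add: act_def adj_mult mult.assoc)

lemma act_one_pos_inv:
  fixes g :: "'a::cstar_algebra"
  assumes "g \<in> units"
  shows "act g 1 \<in> pos_inv"
  using adj_mult_self_positive[of "adj g"] units_mult[OF assms adj_inverse_of(1)[OF assms]]
  by (simp add: pos_inv_def act_one adj_adj)

text \<open>
  The inverse of \<open>a\<^sup>-\<^sup>1\<^sup>/\<^sup>2\<close> is a square root of \<open>a\<close>.
\<close>

lemma pos_inv_sqrtE:
  fixes a :: "'a::cstar_algebra"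
  assumes a: "a \<in> pos_inv"
  obtains s where "s \<in> units" "adj s = s" "a = s * s"
proof
  let ?c = "inv_sqrt a"
  note c = inv_sqrt[OF a]
  show "inverse_of ?c \<in> units" "adj (inverse_of ?c) = inverse_of ?c"
    using c adj_inverse_of[OF c(2)] by (simp_all add: inverse_of_units)
  have "a \<in> units"
    using a pos_inv_iff by blast
  have "inverse_of ?c * (inverse_of ?c * (?c * ?c)) = 1"
    using c(2) by (simp add: inverse_of_units inverse_of_units_cancel)
  then have "inverse_of ?c * (inverse_of ?c * inverse_of a) = 1"
    by (simp only: c(3))
  then have "a = inverse_of ?c * (inverse_of ?c * inverse_of a) * a"
    by simp
  also have "\<dots> = inverse_of ?c * inverse_of ?c * (inverse_of a * a)"
    by (simp only: mult.assoc)
  finally show "a = inverse_of ?c * inverse_of ?c"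
    using \<open>a \<in> units\<close> by (simp add: inverse_of_units)
qed

lemma act_pos_inv:
  fixes a g :: "'a::cstar_algebra"
  assumes "g \<in> units" "a \<in> pos_inv"
  shows "act g a \<in> pos_inv"
proof -
  obtain s where "s \<in> units" "adj s = s" "a = s * s"
    using assms(2) by (rule pos_inv_sqrtE)
  then have "act g a = act (g * s) 1"
    by (simp add: act_def adj_mult mult.assoc)
  then show ?thesis
    using \<open>s \<in> units\<close> assms(1) by (simp add: act_one_pos_inv units_mult)
qed

lemma one_pos_inv: "1 \<in> pos_inv"
  using act_one_pos_inv[OF units_one] by (simp add: act_def)

lemma inverse_of_act:
  fixes a g :: "'a::cstar_algebra"
  assumes "g \<in> units" "a \<in> units"
  shows "inverse_of (act g a) = inverse_of (adj g) * inverse_of a * inverse_of g"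
  using assms adj_inverse_of(1)[OF assms(1)]
  by (intro inverse_of_eqI)
    (simp_all add: act_def mult.assoc inverse_of_units inverse_of_units_cancel)

section \<open>The metric\<close>

text \<open>
  With \<open>c = a\<^sup>-\<^sup>1\<^sup>/\<^sup>2\<close>, the element \<open>c b c\<close> in the definition of the metric is \<open>c (b a\<^sup>-\<^sup>1) c\<^sup>-\<^sup>1\<close>, so the two
  have the same spectrum. The element \<open>b a\<^sup>-\<^sup>1\<close> need not be self-adjoint, but it behaves well under
  congruence.
\<close>

lemma pdist_le_iff:
  fixes a b :: "'a::cstar_algebra"
  assumes a: "a \<in> pos_inv" and b: "b \<in> pos_inv"
  shows "pdist a b \<le> r \<longleftrightarrow> (\<forall>t\<in>real_spectrum (b * inverse_of a). \<bar>ln t\<bar> \<le> r)"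
proof -
  define c where "c = inv_sqrt a"
  note c = inv_sqrt[OF a, folded c_def]
  have e: "c * b * c = act c b" "c * b * c = c * (b * inverse_of a) * inverse_of c"
    using c by (simp_all add: act_def mult.assoc inverse_of_units flip: c(3))
  have "act c b \<in> pos_inv"
    by (rule act_pos_inv[OF c(2) b])
  then have "norm (cfc ln (act c b)) \<le> r \<longleftrightarrow> (\<forall>t\<in>real_spectrum (act c b). \<bar>ln t\<bar> \<le> r)"
    by (intro norm_cfc_le_iff approximable_pos_inv) (auto simp: pos_inv_iff intro!: continuous_intros)
  moreover have "real_spectrum (act c b) = real_spectrum (b * inverse_of a)"
    using e c spectrum_conj[of c "b * inverse_of a"] by (simp add: real_spectrum_def)
  ultimately show ?thesis
    by (simp add: pdist_def e flip: c_def)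
qed

text \<open>A congruence by \<open>g\<close> conjugates \<open>b a\<^sup>-\<^sup>1\<close> by \<open>g\<close>.\<close>

lemma pdist_act:
  fixes a b g :: "'a::cstar_algebra"
  assumes g: "g \<in> units" and a: "a \<in> pos_inv" and b: "b \<in> pos_inv"
  shows "pdist (act g a) (act g b) = pdist a b"
proof -
  have "a \<in> units"
    using a pos_inv_iff by blast
  then have "act g b * inverse_of (act g a) = g * (b * inverse_of a) * inverse_of g"
    unfolding inverse_of_act[OF g \<open>a \<in> units\<close>]
    using adj_inverse_of(1)[OF g] by (simp add: act_def mult.assoc inverse_of_units_cancel)
  then have "real_spectrum (act g b * inverse_of (act g a)) = real_spectrum (b * inverse_of a)"
    using spectrum_conj[OF g] by (simp add: real_spectrum_def)
  then have "pdist (act g a) (act g b) \<le> r \<longleftrightarrow> pdist a b \<le> r" for r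
    by (simp add: pdist_le_iff act_pos_inv assms)
  then show ?thesis
    by (meson order_antisym order_refl)
qed

text \<open>
  The largest points of the spectra of \<open>a\<close> and \<open>a\<^sup>-\<^sup>1\<close> are \<open>\<parallel>a\<parallel>\<close> and \<open>\<parallel>a\<^sup>-\<^sup>1\<parallel>\<close>, and the second
  spectrum consists of the reciprocals of the first.
\<close>

lemma pdist_one_le_iff:
  fixes a :: "'a::cstar_algebra"
  assumes a: "a \<in> pos_inv"
  shows "pdist 1 a \<le> r \<longleftrightarrow> norm a \<le> exp r \<and> norm (inverse_of a) \<le> exp r"
proof -
  have u: "a \<in> units" and sa: "adj a = a" and pos: "\<And>t. t \<in> real_spectrum a \<Longrightarrow> 0 < t"
    using a pos_inv_iff by blast+
  have u': "inverse_of a \<in> units" and sa': "adj (inverse_of a) = inverse_of a"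
    using inverse_of_units(3)[OF u] adj_inverse_of[OF u] sa by simp_all
  have ii: "inverse_of (inverse_of a) = a"
    by (rule inverse_of_eqI) (simp_all add: inverse_of_units u)
  have [simp]: "inverse_of (1::'a) = 1"
    by (rule inverse_of_eqI) simp_all
  have ln_iff: "\<bar>ln t\<bar> \<le> r \<longleftrightarrow> t \<le> exp r \<and> 1 / t \<le> exp r" if "t > 0" for t :: real
  proof -
    have "t \<le> exp r \<longleftrightarrow> ln t \<le> r"
      using that ln_le_cancel_iff[of t "exp r"] by simp
    moreover have "1 / t \<le> exp r \<longleftrightarrow> ln (1 / t) \<le> r"
      using that ln_le_cancel_iff[of "1 / t" "exp r"] by simp
    moreover have "ln (1 / t) = - ln t"
      using that by (simp add: ln_div)
    ultimately show ?thesis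
      by (auto simp: abs_le_iff)
  qed
  have "pdist 1 a \<le> r \<longleftrightarrow> (\<forall>t\<in>real_spectrum a. t \<le> exp r \<and> 1 / t \<le> exp r)"
    using pos ln_iff by (simp add: pdist_le_iff[OF one_pos_inv a])
  also have "\<dots> \<longleftrightarrow> norm a \<le> exp r \<and> norm (inverse_of a) \<le> exp r"
  proof safe
    assume *: "\<forall>t\<in>real_spectrum a. t \<le> exp r \<and> 1 / t \<le> exp r"
    show "norm a \<le> exp r"
      unfolding norm_le_iff_spectrum[OF sa] using * pos by (auto simp: less_imp_le dest!: pos)
    show "norm (inverse_of a) \<le> exp r"
      unfolding norm_le_iff_spectrum[OF sa']
    proof
      fix t assume t: "t \<in> real_spectrum (inverse_of a)"
      have "t \<noteq> 0"
        using t u' zero_spectrum_iff[of "inverse_of a"] by (auto simp: real_spectrum_def)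
      then have "1 / t \<in> real_spectrum a"
        using real_spectrum_inverse[OF u' _ t] by (simp add: ii)
      then show "\<bar>t\<bar> \<le> exp r"
        using * pos[of "1 / t"] by auto
    qed
  next
    fix t assume t: "t \<in> real_spectrum a" and n: "norm a \<le> exp r" "norm (inverse_of a) \<le> exp r"
    show "t \<le> exp r"
      using real_spectrum_norm_le[OF t] n by linarith
    show "1 / t \<le> exp r"
      using real_spectrum_norm_le[OF real_spectrum_inverse[OF u _ t]] pos[OF t] n by simp
  qed
  finally show ?thesis .
qed

lemma pdist_one_act_le_iff:
  fixes g :: "'a::cstar_algebra"
  assumes g: "g \<in> units"
  shows "pdist 1 (act g 1) \<le> r \<longleftrightarrow> norm g \<le> exp (r/2) \<and> norm (inverse_of g) \<le> exp (r/2)"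
proof -
  have "inverse_of (act g 1) = adj (inverse_of g) * inverse_of g"
    using inverse_of_act[OF g units_one] inverse_of_eqI[of 1 "1::'a"] adj_inverse_of[OF g] by simp
  then have n: "norm (inverse_of (act g 1)) = (norm (inverse_of g))\<^sup>2" "norm (act g 1) = (norm g)\<^sup>2"
    by (simp_all add: cstar_identity cstar_identity' act_one)
  have "x\<^sup>2 \<le> exp r \<longleftrightarrow> x \<le> exp (r/2)" if "x \<ge> 0" for x
  proof -
    have "exp r = (exp (r/2))\<^sup>2"
      by (simp flip: exp_double)
    then show ?thesis
      using that by (simp add: power_mono_iff)
  qed
  then show ?thesis
    by (simp add: pdist_one_le_iff act_one_pos_inv g n)
qed

section \<open>Fixed points and unitarizers\<close>

lemma inverse_of_scaleR:
  fixes s :: "'a::cstar_algebra"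
  assumes "s \<in> units" "t \<noteq> 0"
  shows "inverse_of (t *\<^sub>R s) = (1/t) *\<^sub>R inverse_of s"
  using assms by (intro inverse_of_eqI) (simp_all add: inverse_of_units)

lemma unitarizer_scaleR:
  fixes s :: "'a::cstar_algebra"
  assumes "s \<in> unitarizers H" "t \<noteq> 0"
  shows "t *\<^sub>R s \<in> unitarizers H"
  using assms by (simp add: unitarizers_def inverse_of_scaleR units_scaleR)

text \<open>
  With \<open>u = s\<^sup>-\<^sup>1 h s\<close> one has \<open>h s = s u\<close>, so \<open>h s s\<^sup>* h\<^sup>* = s (u u\<^sup>*) s\<^sup>*\<close>, which equals \<open>s s\<^sup>*\<close> exactly if
  \<open>u u\<^sup>* = 1\<close>. A fixed point is of the form \<open>s s\<^sup>*\<close> with \<open>s\<close> its square root.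
\<close>

lemma fixed_points_eq_act_unitarizers:
  fixes H :: "'a::cstar_algebra set"
  assumes H: "H \<subseteq> units"
  shows "fixed_points H = (\<lambda>s. act s 1) ` unitarizers H"
proof (intro equalityI subsetI)
  fix a assume a: "a \<in> fixed_points H"
  then obtain s where s: "s \<in> units" "adj s = s" "a = s * s"
    using pos_inv_sqrtE by (auto simp: fixed_points_def)
  define s' where "s' = inverse_of s"
  have s': "adj s' = s'"
    using adj_inverse_of[OF s(1)] s(2) by (simp add: s'_def)
  have "is_unitary (s' * h * s)" if h: "h \<in> H" for h
  proof -
    define u where "u = s' * h * s"
    have "h * (s * (s * adj h)) = s * s"
      using a h by (simp add: fixed_points_def act_def s(3) mult.assoc)
    then have "u * adj u = s' * (s * (s * s'))"
      by (simp add: u_def adj_mult s s' mult.assoc) (metis mult.assoc)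
    then have 1: "u * adj u = 1"
      by (simp add: s'_def inverse_of_units_cancel inverse_of_units s(1))
    have "u \<in> units"
      using h H s(1) by (auto simp: u_def s'_def inverse_of_units intro!: units_mult)
    then have "adj u * u = 1"
      using 1 by (metis inverse_of_units(2) inverse_of_units_cancel(2) mult_1_right)
    then show ?thesis
      using 1 by (simp add: is_unitary_def u_def)
  qed
  then have "s \<in> unitarizers H"
    using s(1) by (simp add: unitarizers_def s'_def)
  then show "a \<in> (\<lambda>s. act s 1) ` unitarizers H"
    using s by (intro image_eqI[of _ _ s]) (simp_all add: act_one)
next
  fix a assume "a \<in> (\<lambda>s. act s 1) ` unitarizers H"
  then obtain s where s: "a = act s 1" "s \<in> units" "\<And>h. h \<in> H \<Longrightarrow> is_unitary (inverse_of s * h * s)"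
    by (auto simp: unitarizers_def)
  have "act h a = a" if "h \<in> H" for h
  proof -
    define u where "u = inverse_of s * h * s"
    have "h * s = s * u"
      by (simp add: u_def mult.assoc inverse_of_units_cancel s(2))
    then have "act h a = act s (act u 1)"
      by (simp add: s(1) act_act)
    also have "act u 1 = 1"
      using s(3)[OF that] by (simp add: act_one is_unitary_def u_def)
    finally show ?thesis
      by (simp add: s(1))
  qed
  then show "a \<in> fixed_points H"
    using s by (simp add: fixed_points_def act_one_pos_inv)
qed

section \<open>Logarithms in the extended reals\<close>

text \<open>
  An extended real is determined by its comparisons with real numbers. As \<open>log_ereal\<close> and the
  exponential form a Galois connection on both sides, equalities between suprema, infima and
  logarithms become equivalences between inequalities of real numbers, and infinite values and
  empty index sets need no separate treatment.
\<close>

lemma le_log_ereal_iff: "ereal r \<le> log_ereal x \<longleftrightarrow> ereal (exp r) \<le> x"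
proof (cases x)
  case (real y)
  then show ?thesis
    using exp_gt_zero[of r] by (auto simp: log_ereal_def ln_ge_iff simp del: exp_gt_zero)
qed (auto simp: log_ereal_def)

lemma log_ereal_le_iff: "log_ereal x \<le> ereal r \<longleftrightarrow> x \<le> ereal (exp r)"
proof (cases x)
  case (real y)
  then show ?thesis
    using exp_gt_zero[of r] ln_le_cancel_iff[of y "exp r"]
    by (auto simp: log_ereal_def simp del: ln_le_cancel_iff exp_gt_zero)
qed (auto simp: log_ereal_def)

lemma ereal_eqI_upper: "x = y" if "\<And>r. x \<le> ereal r \<longleftrightarrow> y \<le> ereal r" for x y :: ereal
  using that by (intro order_antisym) (auto intro: ereal_le_real)

lemma ereal_eqI_lower:
  fixes x y :: ereal
  assumes *: "\<And>r. ereal r \<le> x \<longleftrightarrow> ereal r \<le> y"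
  shows "x = y"
proof -
  have "- x = - y"
    by (rule ereal_eqI_upper) (metis * ereal_minus_le_minus ereal_uminus_uminus uminus_ereal.simps(1))
  then show ?thesis
    by simp
qed

lemma two_times_ereal_le_iff: "2 * x \<le> ereal r \<longleftrightarrow> x \<le> ereal (r/2)"
  by (cases x) auto

section \<open>Distance and diameter of the orbit of the identity\<close>

theorem theorem3p5:
  fixes H :: "'a::cstar_algebra set"
  assumes "subgroup H (inv_group :: 'a monoid)"
  shows "psetdist (orbit H 1) (fixed_points H) = psetdist {1} (fixed_points H)
       \<and> psetdist {1} (fixed_points H) = log_ereal (sim_number H)
       \<and> pdiam (orbit H 1) = 2 * log_ereal (group_size H)"
proof (intro conjI)
  have H: "H \<subseteq> units" and one: "1 \<in> H"
    and mult: "\<And>g h. g \<in> H \<Longrightarrow> h \<in> H \<Longrightarrow> g * h \<in> H"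
    and inv: "\<And>g. g \<in> H \<Longrightarrow> inverse_of g \<in> H"
    using subgroup.subset[OF assms] subgroup.one_closed[OF assms] subgroup.m_closed[OF assms]
      subgroup.m_inv_closed[OF assms] by auto
  have "pdist (act h 1) y = pdist 1 y" if "h \<in> H" "y \<in> fixed_points H" for h y
    using pdist_act[of h 1 y] that H one_pos_inv by (auto simp: fixed_points_def)
  then have "(INF y\<in>fixed_points H. ereal (pdist x y)) = (INF y\<in>fixed_points H. ereal (pdist 1 y))"
    if "x \<in> orbit H 1" for x
    using that by (auto simp: orbit_def intro!: INF_cong)
  moreover have "orbit H 1 \<noteq> {}"
    using one by (auto simp: orbit_def)
  ultimately show "psetdist (orbit H 1) (fixed_points H) = psetdist {1} (fixed_points H)"
    unfolding psetdist_def by (simp cong: INF_cong)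

  show "psetdist {1} (fixed_points H) = log_ereal (sim_number H)"
  proof (rule ereal_eqI_lower)
    fix r
    have "ereal r \<le> psetdist {1} (fixed_points H) \<longleftrightarrow>
        (\<forall>s\<in>unitarizers H. r \<le> pdist 1 (act s 1))"
      by (simp add: psetdist_def fixed_points_eq_act_unitarizers[OF H] le_INF_iff)
    also have "\<dots> \<longleftrightarrow> (\<forall>s\<in>unitarizers H. exp r \<le> norm s * norm (inverse_of s))"
    proof safe
      fix s assume *: "\<forall>s\<in>unitarizers H. r \<le> pdist 1 (act s 1)" and s: "s \<in> unitarizers H"
      then have u: "s \<in> units"
        by (simp add: unitarizers_def)
      define n n' where "n = norm s" and "n' = norm (inverse_of s)"
      have nn: "n * n' \<ge> 1"
        using norm_units_ge_1[OF u] by (simp add: n_def n'_def)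
      then have n: "n > 0" "n' > 0"
        by (auto simp: n_def n'_def less_le)
      \<comment> \<open>This multiple makes the norms of \<open>t *\<^sub>R s\<close> and its inverse equal; \<open>exp (p/2)\<close> is their common value.\<close>
      define t where "t = sqrt (n' / n)"
      have "t > 0"
        using n by (simp add: t_def)
      define p where "p = ln (n * n')"
      have p: "exp (p/2) = sqrt (n * n')"
        using nn by (simp add: p_def flip: ln_sqrt)
      have "t * n = exp (p/2)" "(1/t) * n' = exp (p/2)"
        unfolding p t_def using n by (simp_all add: real_sqrt_divide real_sqrt_mult field_simps)
      then have "pdist 1 (act (t *\<^sub>R s) 1) \<le> p"
        using \<open>t > 0\<close> u
        by (simp add: pdist_one_act_le_iff units_scaleR inverse_of_scaleR n_def n'_def)
      moreover have "r \<le> pdist 1 (act (t *\<^sub>R s) 1)"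
        using * unitarizer_scaleR[OF s] \<open>t > 0\<close> by auto
      ultimately have "exp r \<le> exp p"
        by simp
      also have "exp p = n * n'"
        using nn by (simp add: p_def)
      finally show "exp r \<le> norm s * norm (inverse_of s)"
        by (simp add: n_def n'_def)
    next
      fix s assume *: "\<forall>s\<in>unitarizers H. exp r \<le> norm s * norm (inverse_of s)"
        and s: "s \<in> unitarizers H"
      define p where "p = pdist 1 (act s 1)"
      have "norm s \<le> exp (p/2) \<and> norm (inverse_of s) \<le> exp (p/2)"
        using s by (simp add: p_def unitarizers_def flip: pdist_one_act_le_iff)
      then have "norm s * norm (inverse_of s) \<le> exp (p/2) * exp (p/2)"
        by (intro mult_mono) auto
      then have "exp r \<le> exp (p/2) * exp (p/2)"
        using * s by (meson order_trans)
      then show "r \<le> pdist 1 (act s 1)"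
        by (simp add: p_def flip: exp_add)
    qed
    also have "\<dots> \<longleftrightarrow> ereal r \<le> log_ereal (sim_number H)"
      by (simp add: le_log_ereal_iff sim_number_def le_INF_iff)
    finally show "ereal r \<le> psetdist {1} (fixed_points H) \<longleftrightarrow> ereal r \<le> log_ereal (sim_number H)" .
  qed

  show "pdiam (orbit H 1) = 2 * log_ereal (group_size H)"
  proof (rule ereal_eqI_upper)
    fix r
    have translate: "pdist (act h 1) (act k 1) = pdist 1 (act (inverse_of h * k) 1)"
      if "h \<in> H" "k \<in> H" for h k
    proof -
      have "h \<in> units" "inverse_of h * k \<in> units"
        using that H mult inv by blast+
      then show ?thesis
        using pdist_act[of h 1 "act (inverse_of h * k) 1"]
        by (simp add: act_act inverse_of_units_cancel one_pos_inv act_one_pos_inv)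
    qed
    have "pdiam (orbit H 1) \<le> ereal r \<longleftrightarrow> (\<forall>h\<in>H. \<forall>k\<in>H. pdist (act h 1) (act k 1) \<le> r)"
      by (auto simp: pdiam_def SUP_le_iff orbit_def)
    also have "\<dots> \<longleftrightarrow> (\<forall>g\<in>H. pdist 1 (act g 1) \<le> r)"
    proof safe
      fix g assume *: "\<forall>h\<in>H. \<forall>k\<in>H. pdist (act h 1) (act k 1) \<le> r" and g: "g \<in> H"
      have "act 1 1 = (1::'a)"
        by (simp add: act_def)
      then show "pdist 1 (act g 1) \<le> r"
        using * one g by metis
    qed (simp add: translate mult inv)
    also have "\<dots> \<longleftrightarrow> (\<forall>g\<in>H. norm g \<le> exp (r/2))"
      using H inv by (auto simp: pdist_one_act_le_iff subset_iff)
    also have "\<dots> \<longleftrightarrow> 2 * log_ereal (group_size H) \<le> ereal r"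
      unfolding two_times_ereal_le_iff log_ereal_le_iff group_size_def SUP_le_iff by simp
    finally show "pdiam (orbit H 1) \<le> ereal r \<longleftrightarrow> 2 * log_ereal (group_size H) \<le> ereal r" .
  qed
qed

end
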